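(* Let $H\Gamma=(V,E,r,s)$ be a finite hypergraph, let $w\in V$ be a source, and assume that $H\Gamma$ is locally ultra at $w$. Let $H\Gamma_S$ be the hypergraph obtained from $H\Gamma$ by removing the source $w$ (move S). Then there is a $*$-homomorphism $\pi:C^*(H\Gamma_S)\to C^*(H\Gamma)$ such that the $*$-subalgebra $\mathrm{Im}(\pi)$ is a full corner in $C^*(H\Gamma)$.
   Context: A (finite directed) hypergraph $H\Gamma=(V,E,r,s)$ consists of finite sets $V$ (vertices) and $E$ (edges) and maps $r,s:E\to\mathcal P(V)\setminus\{\emptyset\}$ (range and source), where $\mathcal P(V)$ is the power set. A vertex $v$ is a sink if $v\notin s(e)$ for all $e\in E$, and a source if $v\notin r(e)$ for all $e\in E$. The hypergraph $C^*$-algebra $C^*(H\Gamma)$ is the universal $C^*$-algebra generated by mutually orthogonal projections $p_v$ ($v\in V$) and partial isometries $s_e$ ($e\in E$) such that: (HR1) $s_e^*s_f=\delta_{ef}\sum_{v\in r(e)}p_v$ for all $e,f\in E$; (HR2a) $s_es_e^*\le\sum_{v\in s(e)}p_v$ for all $e\in E$; (HR2b) $p_v\le\sum_{e\in E,\,v\in s(e)}s_es_e^*$ for all $v\in V$ that are not sinks. $H\Gamma$ is locally ultra at $w$ if for all $e\in E$, $w\in s(e)$ implies $s(e)=\{w\}$. Move S at a source $w$ produces $H\Gamma_S=(V_S,E_S,r_S,s_S)$ with $V_S=V\setminus\{w\}$, $E_S=E\setminus\{e\in E\mid w\in s(e)\}$, $s_S=s|_{E_S}$, $r_S=r|_{E_S}$.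 A corner of a $C^*$-algebra $A$ is a subalgebra $pAp$ with $p$ a projection (in $A$ or its multiplier algebra); it is full if it is not contained in any proper closed two-sided ideal of $A$.
   Formalization: The source w is additionally assumed not to be a sink; for an isolated w the claim fails, e.g. V={v,w} with no edges gives C*(HΓ)=C² and C*(HΓ_S)=C, whose image is never a full corner. *)

theory Defs
  imports "HOL-Analysis.Analysis" "HOL-Probability.Discrete_Topology"
begin

section \<open>\<open>C\<^sup>*\<close>-algebras\<close>

class scaleC =
  fixes scaleC :: "complex \<Rightarrow> 'a \<Rightarrow> 'a"  (infixr \<open>*\<^sub>C\<close> 75)

class star =
  fixes star :: "'a \<Rightarrow> 'a"

class cstar_algebra = real_normed_algebra + banach + scaleC + star +
  assumes scaleC_add_right: "c *\<^sub>C (x + y) = c *\<^sub>C x + c *\<^sub>C y"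
    and scaleC_add_left: "(c + d) *\<^sub>C x = c *\<^sub>C x + d *\<^sub>C x"
    and scaleC_scaleC: "c *\<^sub>C d *\<^sub>C x = (c * d) *\<^sub>C x"
    and scaleR_scaleC: "r *\<^sub>R x = complex_of_real r *\<^sub>C x"
    and norm_scaleC: "norm (c *\<^sub>C x) = cmod c * norm x"
    and scaleC_mult_left: "(c *\<^sub>C x) * y = c *\<^sub>C (x * y)"
    and scaleC_mult_right: "x * (c *\<^sub>C y) = c *\<^sub>C (x * y)"
    and star_star: "star (star x) = x"
    and star_add: "star (x + y) = star x + star y"
    and star_scaleC: "star (c *\<^sub>C x) = cnj c *\<^sub>C star x"
    and star_mult: "star (x * y) = star y * star x"
    and cstar_identity: "norm (star x * x) = (norm x)\<^sup>2"

definition projection :: "'a::cstar_algebra \<Rightarrow> bool" where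
  "projection p \<longleftrightarrow> star p = p \<and> p * p = p"

definition partial_isometry :: "'a::cstar_algebra \<Rightarrow> bool" where
  "partial_isometry s \<longleftrightarrow> s * star s * s = s"

definition cstar_le :: "'a::cstar_algebra \<Rightarrow> 'a \<Rightarrow> bool"  (infix \<open>\<sqsubseteq>\<close> 50) where
  "x \<sqsubseteq> y \<longleftrightarrow> (\<exists>z. y - x = star z * z)"

text \<open>
  A norm-closed \<open>*\<close>-subalgebra of a \<open>C\<^sup>*\<close>-algebra is a \<open>C\<^sup>*\<close>-algebra; the \<open>C\<^sup>*\<close>-algebras that occur
  below are given as such subsets of an ambient type of class \<^class>\<open>cstar_algebra\<close>.
\<close>

definition cstar_subalgebra :: "'a::cstar_algebra set \<Rightarrow> bool" where
  "cstar_subalgebra A \<longleftrightarrow> closed A \<and> 0 \<in> A \<and>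
     (\<forall>x\<in>A. \<forall>y\<in>A. x + y \<in> A \<and> x * y \<in> A) \<and> (\<forall>x\<in>A. star x \<in> A \<and> (\<forall>c. c *\<^sub>C x \<in> A))"

definition cstar_generated :: "'a::cstar_algebra set \<Rightarrow> 'a set" where
  "cstar_generated G = \<Inter> {A. cstar_subalgebra A \<and> G \<subseteq> A}"

definition star_hom :: "'a::cstar_algebra set \<Rightarrow> 'b::cstar_algebra set \<Rightarrow> ('a \<Rightarrow> 'b) \<Rightarrow> bool" where
  "star_hom A B f \<longleftrightarrow> f ` A \<subseteq> B \<and>
     (\<forall>x\<in>A. \<forall>y\<in>A. f (x + y) = f x + f y \<and> f (x * y) = f x * f y) \<and>
     (\<forall>x\<in>A. f (star x) = star (f x) \<and> (\<forall>c. f (c *\<^sub>C x) = c *\<^sub>C f x))"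

definition closed_ideal :: "'a::cstar_algebra set \<Rightarrow> 'a set \<Rightarrow> bool" where
  "closed_ideal A J \<longleftrightarrow> J \<subseteq> A \<and> closed J \<and> 0 \<in> J \<and>
     (\<forall>x\<in>J. \<forall>y\<in>J. x + y \<in> J) \<and> (\<forall>x\<in>J. \<forall>c. c *\<^sub>C x \<in> J) \<and>
     (\<forall>a\<in>A. \<forall>x\<in>J. a * x \<in> J \<and> x * a \<in> J)"

text \<open>
  The projection is taken in \<open>A\<close> itself. For unital \<open>A\<close>, such as the \<open>C\<^sup>*\<close>-algebra of a finite
  hypergraph with unit \<open>\<Sum>v\<in>V. p\<^sub>v\<close>, the multiplier algebra is \<open>A\<close>.
\<close>

definition corner :: "'a::cstar_algebra set \<Rightarrow> 'a set \<Rightarrow> bool" where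
  "corner A C \<longleftrightarrow> (\<exists>p\<in>A. projection p \<and> C = {p * a * p |a. a \<in> A})"

definition full_corner :: "'a::cstar_algebra set \<Rightarrow> 'a set \<Rightarrow> bool" where
  "full_corner A C \<longleftrightarrow> corner A C \<and> (\<forall>J. closed_ideal A J \<and> C \<subseteq> J \<longrightarrow> J = A)"


section \<open>The Hilbert space \<open>\<ell>\<^sup>2(\<nat>)\<close>\<close>

typedef ell2 = "{f :: nat \<Rightarrow> complex. summable (\<lambda>n. (cmod (f n))\<^sup>2)}"
  morphisms ell2_coeff Abs_ell2
  by (rule exI[of _ "\<lambda>_. 0"]) simp

setup_lifting type_definition_ell2

lemma summable_ell2: "summable (\<lambda>n. (cmod (ell2_coeff x n))\<^sup>2)"
  using ell2_coeff by blast

lemma ell2_eqI: "(\<And>n. ell2_coeff x n = ell2_coeff y n) \<Longrightarrow> x = y"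
  by (metis ell2_coeff_inject ext)

lemma summable_sq_add:
  fixes f g :: "nat \<Rightarrow> complex"
  assumes "summable (\<lambda>n. (cmod (f n))\<^sup>2)" "summable (\<lambda>n. (cmod (g n))\<^sup>2)"
  shows "summable (\<lambda>n. (cmod (f n + g n))\<^sup>2)"
proof (rule summable_comparison_test')
  show "summable (\<lambda>n. 2 * (cmod (f n))\<^sup>2 + 2 * (cmod (g n))\<^sup>2)"
    by (intro summable_add summable_mult assms)
  fix n
  have "(cmod (f n + g n))\<^sup>2 \<le> (cmod (f n) + cmod (g n))\<^sup>2"
    by (simp add: norm_triangle_ineq power_mono)
  also have "\<dots> \<le> 2 * (cmod (f n))\<^sup>2 + 2 * (cmod (g n))\<^sup>2"
    using sum_squares_bound[of "cmod (f n)" "cmod (g n)"] by (simp add: power2_sum)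
  finally show "norm ((cmod (f n + g n))\<^sup>2) \<le> 2 * (cmod (f n))\<^sup>2 + 2 * (cmod (g n))\<^sup>2" by simp
qed

lemma summable_sq_scale:
  fixes f :: "nat \<Rightarrow> complex"
  shows "summable (\<lambda>n. (cmod (f n))\<^sup>2) \<Longrightarrow> summable (\<lambda>n. (cmod (c * f n))\<^sup>2)"
  by (simp add: norm_mult power_mult_distrib summable_mult)

instantiation ell2 :: "{real_vector, scaleC}"
begin

lift_definition zero_ell2 :: ell2 is "\<lambda>_. 0" by simp
lift_definition plus_ell2 :: "ell2 \<Rightarrow> ell2 \<Rightarrow> ell2" is "\<lambda>f g n. f n + g n"
  by (rule summable_sq_add)
lift_definition uminus_ell2 :: "ell2 \<Rightarrow> ell2" is "\<lambda>f n. - f n" by simp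
lift_definition minus_ell2 :: "ell2 \<Rightarrow> ell2 \<Rightarrow> ell2" is "\<lambda>f g n. f n - g n"
  subgoal for f g using summable_sq_add[of f "\<lambda>n. - g n"] by simp
  done
lift_definition scaleC_ell2 :: "complex \<Rightarrow> ell2 \<Rightarrow> ell2" is "\<lambda>c f n. c * f n"
  by (rule summable_sq_scale)
lift_definition scaleR_ell2 :: "real \<Rightarrow> ell2 \<Rightarrow> ell2" is "\<lambda>r f n. complex_of_real r * f n"
  by (rule summable_sq_scale)

instance
  by standard (transfer; simp add: algebra_simps)+

end

lemmas ell2_coeff_simps [simp] =
  zero_ell2.rep_eq plus_ell2.rep_eq uminus_ell2.rep_eq minus_ell2.rep_eq
  scaleC_ell2.rep_eq scaleR_ell2.rep_eq

definition cinner :: "ell2 \<Rightarrow> ell2 \<Rightarrow> complex" where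
  "cinner x y = (\<Sum>n. cnj (ell2_coeff x n) * ell2_coeff y n)"

lemma summable_norm_cinner: "summable (\<lambda>n. norm (cnj (ell2_coeff x n) * ell2_coeff y n))"
proof (rule summable_comparison_test')
  show "summable (\<lambda>n. (cmod (ell2_coeff x n))\<^sup>2 + (cmod (ell2_coeff y n))\<^sup>2)"
    by (intro summable_add summable_ell2)
  fix n
  have "2 * (cmod (ell2_coeff x n) * cmod (ell2_coeff y n))
          \<le> (cmod (ell2_coeff x n))\<^sup>2 + (cmod (ell2_coeff y n))\<^sup>2"
    using sum_squares_bound[of "cmod (ell2_coeff x n)" "cmod (ell2_coeff y n)"] by simp
  moreover have "0 \<le> cmod (ell2_coeff x n) * cmod (ell2_coeff y n)" by simp
  ultimately have "cmod (ell2_coeff x n) * cmod (ell2_coeff y n)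
      \<le> (cmod (ell2_coeff x n))\<^sup>2 + (cmod (ell2_coeff y n))\<^sup>2" by linarith
  then show "norm (norm (cnj (ell2_coeff x n) * ell2_coeff y n))
      \<le> (cmod (ell2_coeff x n))\<^sup>2 + (cmod (ell2_coeff y n))\<^sup>2"
    by (simp add: norm_mult)
qed

lemma summable_cinner: "summable (\<lambda>n. cnj (ell2_coeff x n) * ell2_coeff y n)"
  using summable_norm_cancel[OF summable_norm_cinner] .

lemma cinner_add_left: "cinner (x + y) z = cinner x z + cinner y z"
  unfolding cinner_def by (simp add: distrib_right suminf_add[OF summable_cinner summable_cinner])

lemma cinner_add_right: "cinner x (y + z) = cinner x y + cinner x z"
  unfolding cinner_def by (simp add: distrib_left suminf_add[OF summable_cinner summable_cinner])

lemma cinner_scaleC_left: "cinner (c *\<^sub>C x) y = cnj c * cinner x y"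
  unfolding cinner_def using suminf_mult[OF summable_cinner, of "cnj c" x y] by (simp add: mult_ac)

lemma cinner_scaleC_right: "cinner x (c *\<^sub>C y) = c * cinner x y"
  unfolding cinner_def using suminf_mult[OF summable_cinner, of c x y] by (simp add: mult_ac)

lemma cinner_commute: "cinner x y = cnj (cinner y x)"
proof -
  have "(\<lambda>n. cnj (cnj (ell2_coeff y n) * ell2_coeff x n)) sums cnj (cinner y x)"
    unfolding cinner_def using summable_sums[OF summable_cinner] by (simp only: sums_cnj)
  then show ?thesis
    unfolding cinner_def by (simp add: sums_iff mult.commute)
qed

lemma cinner_self: "cinner x x = complex_of_real (\<Sum>n. (cmod (ell2_coeff x n))\<^sup>2)"
proof -
  have "(\<lambda>n. complex_of_real ((cmod (ell2_coeff x n))\<^sup>2))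
      sums complex_of_real (\<Sum>n. (cmod (ell2_coeff x n))\<^sup>2)"
    using summable_sums[OF summable_ell2] by (simp only: sums_of_real_iff)
  moreover have "complex_of_real ((cmod (ell2_coeff x n))\<^sup>2) = cnj (ell2_coeff x n) * ell2_coeff x n" for n
    by (metis complex_norm_square mult.commute)
  ultimately show ?thesis
    unfolding cinner_def by (simp add: sums_iff)
qed

instantiation ell2 :: real_inner
begin

definition inner_ell2 :: "ell2 \<Rightarrow> ell2 \<Rightarrow> real" where
  "inner_ell2 x y = Re (cinner x y)"
definition norm_ell2 :: "ell2 \<Rightarrow> real" where
  "norm_ell2 x = sqrt (inner x x)"
definition sgn_ell2 :: "ell2 \<Rightarrow> ell2" where
  "sgn_ell2 x = x /\<^sub>R norm x"
definition dist_ell2 :: "ell2 \<Rightarrow> ell2 \<Rightarrow> real" where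
  "dist_ell2 x y = norm (x - y)"
definition uniformity_ell2 :: "(ell2 \<times> ell2) filter" where
  "uniformity_ell2 = (INF e\<in>{0<..}. principal {(x, y). dist x y < e})"
definition open_ell2 :: "ell2 set \<Rightarrow> bool" where
  "open_ell2 U \<longleftrightarrow> (\<forall>x\<in>U. eventually (\<lambda>(x', y). x' = x \<longrightarrow> y \<in> U) uniformity)"

instance
proof
  fix x y z :: ell2 and r :: real
  have scaleR: "r *\<^sub>R x = complex_of_real r *\<^sub>C x" by (rule ell2_eqI) simp
  show "inner x y = inner y x"
    unfolding inner_ell2_def by (subst cinner_commute) simp
  show "inner (x + y) z = inner x z + inner y z"
    by (simp add: inner_ell2_def cinner_add_left)
  show "inner (r *\<^sub>R x) y = r * inner x y"
    by (simp add: inner_ell2_def scaleR cinner_scaleC_left)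
  have self: "inner x x = (\<Sum>n. (cmod (ell2_coeff x n))\<^sup>2)"
    by (simp add: inner_ell2_def cinner_self)
  show "0 \<le> inner x x"
    unfolding self by (intro suminf_nonneg summable_ell2) simp
  show "inner x x = 0 \<longleftrightarrow> x = 0"
    unfolding self using suminf_eq_zero_iff[OF summable_ell2[of x]]
    by (auto intro: ell2_eqI)
qed (rule norm_ell2_def sgn_ell2_def dist_ell2_def uniformity_ell2_def open_ell2_def)+

end

lemma norm_ell2_sq: "(norm (x :: ell2))\<^sup>2 = (\<Sum>n. (cmod (ell2_coeff x n))\<^sup>2)"
  by (simp add: power2_norm_eq_inner inner_ell2_def cinner_self)

lemma cinner_self_norm: "cinner x x = complex_of_real ((norm x)\<^sup>2)"
  by (simp only: norm_ell2_sq cinner_self)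

lemma sum_sq_le_norm: "(\<Sum>n<N. (cmod (ell2_coeff x n))\<^sup>2) \<le> (norm x)\<^sup>2"
  unfolding norm_ell2_sq by (rule sum_le_suminf[OF summable_ell2]) auto

lemma coeff_le_norm: "cmod (ell2_coeff x n) \<le> norm x"
proof -
  have "(cmod (ell2_coeff x n))\<^sup>2 \<le> (\<Sum>k<Suc n. (cmod (ell2_coeff x k))\<^sup>2)"
    by (simp add: sum_nonneg)
  then show ?thesis
    using sum_sq_le_norm[of x "Suc n"] by (meson norm_ge_zero order_trans power2_le_imp_le)
qed

lemma norm_scaleC_ell2: "norm (c *\<^sub>C (x :: ell2)) = cmod c * norm x"
proof -
  have "cinner (c *\<^sub>C x) (c *\<^sub>C x) = (c * cnj c) * cinner x x"
    by (simp add: cinner_scaleC_left cinner_scaleC_right)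
  also have "\<dots> = complex_of_real ((cmod c * norm x)\<^sup>2)"
    by (simp only: cinner_self_norm power_mult_distrib of_real_mult complex_norm_square)
  finally have "cinner (c *\<^sub>C x) (c *\<^sub>C x) = complex_of_real ((cmod c * norm x)\<^sup>2)" .
  then have "(norm (c *\<^sub>C x))\<^sup>2 = (cmod c * norm x)\<^sup>2"
    by (metis cinner_self_norm of_real_eq_iff)
  then show ?thesis by (simp add: power2_eq_iff_nonneg)
qed

lemma norm_cinner_le: "cmod (cinner x y) \<le> norm x * norm y"
proof -
  obtain c where c: "cmod c = 1" "c * cinner x y = complex_of_real (cmod (cinner x y))"
  proof (cases "cinner x y = 0")
    case True then show ?thesis using that[of 1] by simp
  next
    case False
    have "cnj (sgn (cinner x y)) * cinner x y = complex_of_real (cmod (cinner x y))"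
      using False complex_norm_square[of "cinner x y"]
      by (simp add: sgn_eq power2_eq_square field_simps)
    then show ?thesis using that[of "cnj (sgn (cinner x y))"] False by (simp add: norm_sgn)
  qed
  have "cmod (cinner x y) = inner x (c *\<^sub>C y)"
    by (simp add: inner_ell2_def cinner_scaleC_right c)
  also have "\<dots> \<le> norm x * norm (c *\<^sub>C y)" by (rule norm_cauchy_schwarz)
  finally show ?thesis by (simp add: norm_scaleC_ell2 c)
qed

instance ell2 :: complete_space
proof
  fix X :: "nat \<Rightarrow> ell2"
  assume X: "Cauchy X"
  have "Cauchy (\<lambda>k. ell2_coeff (X k) n)" for n
  proof (rule metric_CauchyI)
    fix e :: real assume "e > 0"
    then obtain M where M: "\<And>k m. k \<ge> M \<Longrightarrow> m \<ge> M \<Longrightarrow> dist (X k) (X m) < e"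
      using X unfolding Cauchy_def by blast
    have "dist (ell2_coeff (X k) n) (ell2_coeff (X m) n) \<le> dist (X k) (X m)" for k m
      using coeff_le_norm[of "X k - X m" n] by (simp add: dist_norm)
    then show "\<exists>M. \<forall>m\<ge>M. \<forall>k\<ge>M. dist (ell2_coeff (X m) n) (ell2_coeff (X k) n) < e"
      using M by (meson le_less_trans)
  qed
  then have "\<exists>l. (\<lambda>k. ell2_coeff (X k) n) \<longlonglongrightarrow> l" for n
    by (simp add: Cauchy_convergent_iff convergent_def)
  then obtain L where L: "\<And>n. (\<lambda>k. ell2_coeff (X k) n) \<longlonglongrightarrow> L n" by metis
  have bnd: "\<exists>M. \<forall>m\<ge>M. \<forall>N. (\<Sum>n<N. (cmod (ell2_coeff (X m) n - L n))\<^sup>2) \<le> e\<^sup>2" if "e > 0" for e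
  proof -
    obtain M where M: "\<And>k m. k \<ge> M \<Longrightarrow> m \<ge> M \<Longrightarrow> dist (X k) (X m) < e"
      using X \<open>e > 0\<close> unfolding Cauchy_def by blast
    have "(\<Sum>n<N. (cmod (ell2_coeff (X m) n - L n))\<^sup>2) \<le> e\<^sup>2" if "m \<ge> M" for m N
    proof (rule LIMSEQ_le_const2)
      show "(\<lambda>k. \<Sum>n<N. (cmod (ell2_coeff (X m) n - ell2_coeff (X k) n))\<^sup>2)
          \<longlonglongrightarrow> (\<Sum>n<N. (cmod (ell2_coeff (X m) n - L n))\<^sup>2)"
        by (intro tendsto_intros L)
      have "(\<Sum>n<N. (cmod (ell2_coeff (X m) n - ell2_coeff (X k) n))\<^sup>2) \<le> e\<^sup>2" if "k \<ge> M" for k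
      proof -
        have "(\<Sum>n<N. (cmod (ell2_coeff (X m) n - ell2_coeff (X k) n))\<^sup>2) \<le> (norm (X m - X k))\<^sup>2"
          using sum_sq_le_norm[of "X m - X k" N] by simp
        also have "\<dots> \<le> e\<^sup>2"
          using M[OF \<open>m \<ge> M\<close> that] by (intro power_mono) (auto simp: dist_norm)
        finally show ?thesis .
      qed
      then show "\<exists>K. \<forall>k\<ge>K. (\<Sum>n<N. (cmod (ell2_coeff (X m) n - ell2_coeff (X k) n))\<^sup>2) \<le> e\<^sup>2" by blast
    qed
    then show ?thesis by blast
  qed
  have diff: "summable (\<lambda>n. (cmod (ell2_coeff (X m) n - L n))\<^sup>2)"
    if "\<And>N. (\<Sum>n<N. (cmod (ell2_coeff (X m) n - L n))\<^sup>2) \<le> e" for m e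
    using that by (intro summableI_nonneg_bounded[where x = e]) auto
  obtain M where "\<And>N. (\<Sum>n<N. (cmod (ell2_coeff (X M) n - L n))\<^sup>2) \<le> 1\<^sup>2"
    using bnd[of 1] by auto
  from summable_sq_add[OF summable_ell2[of "X M"], of "\<lambda>n. - (ell2_coeff (X M) n - L n)"] diff[OF this]
  have "summable (\<lambda>n. (cmod (L n))\<^sup>2)" by (simp add: norm_minus_commute)
  then have Lc: "ell2_coeff (Abs_ell2 L) = L" by (simp add: Abs_ell2_inverse)
  have "X \<longlonglongrightarrow> Abs_ell2 L"
  proof (rule metric_LIMSEQ_I)
    fix e :: real assume "e > 0"
    then obtain M where M: "\<And>m N. m \<ge> M \<Longrightarrow> (\<Sum>n<N. (cmod (ell2_coeff (X m) n - L n))\<^sup>2) \<le> (e/2)\<^sup>2"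
      using bnd[of "e/2"] by auto
    have "dist (X m) (Abs_ell2 L) < e" if "m \<ge> M" for m
    proof -
      have "(norm (X m - Abs_ell2 L))\<^sup>2 \<le> (e/2)\<^sup>2"
        unfolding norm_ell2_sq by (intro suminf_le_const summable_ell2) (simp add: Lc M[OF that])
      then have "norm (X m - Abs_ell2 L) \<le> e/2"
        by (rule power2_le_imp_le) (use \<open>e > 0\<close> in simp)
      then show ?thesis using \<open>e > 0\<close> by (simp add: dist_norm)
    qed
    then show "\<exists>M. \<forall>m\<ge>M. dist (X m) (Abs_ell2 L) < e" by blast
  qed
  then show "convergent X" by (auto simp: convergent_def)
qed

instance ell2 :: banach ..


section \<open>The bounded operators on \<open>\<ell>\<^sup>2(\<nat>)\<close>\<close>

lemma cinner_eqI: "(\<And>x. cinner x y = cinner x z) \<Longrightarrow> y = z"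
proof -
  assume eq: "\<And>x. cinner x y = cinner x z"
  have "cinner (y - z) (y - z) + cinner (y - z) z = cinner (y - z) y"
    by (simp flip: cinner_add_right)
  then have "cinner (y - z) (y - z) = 0" using eq by simp
  then show "y = z" by (simp add: cinner_self_norm)
qed

lemma bounded_linear_scaleC_ell2: "bounded_linear (\<lambda>x :: ell2. c *\<^sub>C x)"
  by (rule bounded_linear_intro[where K = "cmod c"])
     (auto intro!: ell2_eqI simp: norm_scaleC_ell2 algebra_simps)

typedef bop = "{T :: ell2 \<Rightarrow>\<^sub>L ell2. \<forall>c x. blinfun_apply T (c *\<^sub>C x) = c *\<^sub>C blinfun_apply T x}"
  morphisms bop_blinfun Abs_bop
  by (rule exI[of _ 0]) (simp add: zero_blinfun.rep_eq ell2_eqI)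

setup_lifting type_definition_bop

definition bop_apply :: "bop \<Rightarrow> ell2 \<Rightarrow> ell2" where
  "bop_apply T = blinfun_apply (bop_blinfun T)"

lemma bop_eqI: "(\<And>x. bop_apply S x = bop_apply T x) \<Longrightarrow> S = T"
  by (metis blinfun_eqI bop_apply_def bop_blinfun_inject)

lemma bop_apply_scaleC: "bop_apply T (c *\<^sub>C x) = c *\<^sub>C bop_apply T x"
  using bop_blinfun[of T] by (simp add: bop_apply_def)

lemma bounded_linear_bop_apply: "bounded_linear (bop_apply T)"
  by (simp add: bop_apply_def[abs_def] blinfun.bounded_linear_right)

instantiation bop :: "{real_algebra, scaleC}"
begin

lift_definition zero_bop :: bop is 0
  by (simp add: zero_blinfun.rep_eq ell2_eqI)
lift_definition plus_bop :: "bop \<Rightarrow> bop \<Rightarrow> bop" is "(+)"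
  by (auto simp: blinfun.add_left intro!: ell2_eqI simp: algebra_simps)
lift_definition uminus_bop :: "bop \<Rightarrow> bop" is uminus
  by (auto simp: blinfun.minus_left intro!: ell2_eqI)
lift_definition minus_bop :: "bop \<Rightarrow> bop \<Rightarrow> bop" is "(-)"
  by (auto simp: blinfun.diff_left intro!: ell2_eqI simp: algebra_simps)
lift_definition scaleR_bop :: "real \<Rightarrow> bop \<Rightarrow> bop" is scaleR
  by (auto simp: blinfun.scaleR_left intro!: ell2_eqI)
lift_definition times_bop :: "bop \<Rightarrow> bop \<Rightarrow> bop" is "(o\<^sub>L)"
  by auto
lift_definition scaleC_bop :: "complex \<Rightarrow> bop \<Rightarrow> bop" is "\<lambda>c T. Blinfun (\<lambda>x. c *\<^sub>C x) o\<^sub>L T"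
  by (auto simp: bounded_linear_Blinfun_apply[OF bounded_linear_scaleC_ell2] intro!: ell2_eqI)
instance
proof
  fix a b c :: bop and r s :: real
  show "a + b + c = a + (b + c)" by transfer simp
  show "a + b = b + a" by transfer simp
  show "0 + a = a" by transfer simp
  show "- a + a = 0" by transfer simp
  show "a - b = a + - b" by transfer simp
  show "r *\<^sub>R (a + b) = r *\<^sub>R a + r *\<^sub>R b" by transfer (simp add: scaleR_add_right)
  show "(r + s) *\<^sub>R a = r *\<^sub>R a + s *\<^sub>R a" by transfer (simp add: scaleR_add_left)
  show "r *\<^sub>R s *\<^sub>R a = (r * s) *\<^sub>R a" by transfer simp
  show "1 *\<^sub>R a = a" by transfer simp
  show "a * b * c = a * (b * c)" by transfer (rule blinfun_eqI, simp)
  show "(a + b) * c = a * c + b * c" by transfer (rule blinfun_eqI, simp add: blinfun.add_left)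
  show "a * (b + c) = a * b + a * c"
    by transfer (rule blinfun_eqI, simp add: blinfun.add_left blinfun.add_right)
  show "r *\<^sub>R a * b = r *\<^sub>R (a * b)"
    by transfer (rule blinfun_eqI, simp add: blinfun.scaleR_left)
  show "a * r *\<^sub>R b = r *\<^sub>R (a * b)"
    by transfer (rule blinfun_eqI, simp add: blinfun.scaleR_left blinfun.scaleR_right)
qed

end

instantiation bop :: real_normed_algebra
begin

lift_definition norm_bop :: "bop \<Rightarrow> real" is norm .

definition sgn_bop :: "bop \<Rightarrow> bop" where
  "sgn_bop x = x /\<^sub>R norm x"
definition dist_bop :: "bop \<Rightarrow> bop \<Rightarrow> real" where
  "dist_bop x y = norm (x - y)"
definition uniformity_bop :: "(bop \<times> bop) filter" where
  "uniformity_bop = (INF e\<in>{0<..}. principal {(x, y). dist x y < e})"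
definition open_bop :: "bop set \<Rightarrow> bool" where
  "open_bop U \<longleftrightarrow> (\<forall>x\<in>U. eventually (\<lambda>(x', y). x' = x \<longrightarrow> y \<in> U) uniformity)"

instance
proof
  fix a b :: bop and r :: real
  show "norm a = 0 \<longleftrightarrow> a = 0" by transfer simp
  show "norm (a + b) \<le> norm a + norm b" by transfer (rule norm_triangle_ineq)
  show "norm (r *\<^sub>R a) = \<bar>r\<bar> * norm a" by transfer simp
  show "norm (a * b) \<le> norm a * norm b" by transfer (rule norm_blinfun_compose)
qed (rule sgn_bop_def dist_bop_def uniformity_bop_def open_bop_def)+

end

lemma bop_apply_simps [simp]:
  "bop_apply 0 x = 0"
  "bop_apply (S + T) x = bop_apply S x + bop_apply T x"
  "bop_apply (S - T) x = bop_apply S x - bop_apply T x"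
  "bop_apply (S * T) x = bop_apply S (bop_apply T x)"
  "bop_apply (r *\<^sub>R T) x = r *\<^sub>R bop_apply T x"
  "bop_apply (c *\<^sub>C T) x = c *\<^sub>C bop_apply T x"
  by (simp_all add: bop_apply_def zero_bop.rep_eq plus_bop.rep_eq minus_bop.rep_eq times_bop.rep_eq
      scaleR_bop.rep_eq scaleC_bop.rep_eq blinfun.add_left blinfun.diff_left blinfun.scaleR_left
      bounded_linear_Blinfun_apply[OF bounded_linear_scaleC_ell2])

lemma norm_bop_apply: "norm (bop_apply T x) \<le> norm T * norm x"
  by (simp add: bop_apply_def norm_bop.rep_eq norm_blinfun)

lemma norm_bop_le: "0 \<le> b \<Longrightarrow> (\<And>x. norm (bop_apply T x) \<le> b * norm x) \<Longrightarrow> norm T \<le> b"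
  by (simp add: bop_apply_def norm_bop.rep_eq norm_blinfun_bound)

lemma bopI:
  fixes f :: "ell2 \<Rightarrow> ell2"
  assumes "\<And>x y. f (x + y) = f x + f y" "\<And>c x. f (c *\<^sub>C x) = c *\<^sub>C f x"
    and "\<And>x. norm (f x) \<le> norm x * K"
  shows "\<exists>S. bop_apply S = f"
proof -
  have "r *\<^sub>R x = complex_of_real r *\<^sub>C x" for r and x :: ell2 by (rule ell2_eqI) simp
  then have "bounded_linear f"
    using assms by (intro bounded_linear_intro[where K = K]) auto
  then show ?thesis
    by (intro exI[of _ "Abs_bop (Blinfun f)"])
       (simp add: bop_apply_def Abs_bop_inverse bounded_linear_Blinfun_apply assms)
qed

instance bop :: complete_space
proof
  fix X :: "nat \<Rightarrow> bop"
  assume "Cauchy X"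
  moreover have "dist (X m) (X n) = dist (bop_blinfun (X m)) (bop_blinfun (X n))" for m n
    by (simp add: dist_bop_def dist_norm norm_bop.rep_eq minus_bop.rep_eq)
  ultimately have "Cauchy (\<lambda>n. bop_blinfun (X n))"
    by (simp add: Cauchy_def)
  then have "convergent (\<lambda>n. bop_blinfun (X n))"
    by (rule Cauchy_convergent)
  then obtain L where L: "(\<lambda>n. bop_blinfun (X n)) \<longlonglongrightarrow> L"
    by (auto simp: convergent_def)
  have "blinfun_apply L (c *\<^sub>C x) = c *\<^sub>C blinfun_apply L x" for c x
  proof (rule LIMSEQ_unique)
    have *: "(\<lambda>n. blinfun_apply (bop_blinfun (X n)) y) \<longlonglongrightarrow> blinfun_apply L y" for y
      by (intro tendsto_intros L)
    show "(\<lambda>n. blinfun_apply (bop_blinfun (X n)) (c *\<^sub>C x)) \<longlonglongrightarrow> blinfun_apply L (c *\<^sub>C x)"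
      by (rule *)
    show "(\<lambda>n. blinfun_apply (bop_blinfun (X n)) (c *\<^sub>C x)) \<longlonglongrightarrow> c *\<^sub>C blinfun_apply L x"
      using bounded_linear.tendsto[OF bounded_linear_scaleC_ell2 *[of x], of c]
      by (simp add: bop_apply_scaleC flip: bop_apply_def)
  qed
  then have "bop_blinfun (Abs_bop L) = L" by (simp add: Abs_bop_inverse)
  then have "X \<longlonglongrightarrow> Abs_bop L"
    using L unfolding tendsto_dist_iff[of X] tendsto_dist_iff[of _ L]
    by (simp add: dist_bop_def dist_norm norm_bop.rep_eq minus_bop.rep_eq)
  then show "convergent X" by (auto simp: convergent_def)
qed

instance bop :: banach ..

definition is_adjoint :: "bop \<Rightarrow> bop \<Rightarrow> bool" where
  "is_adjoint T S \<longleftrightarrow> (\<forall>x y. cinner (bop_apply T x) y = cinner x (bop_apply S y))"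

instantiation bop :: star
begin
definition star_bop :: "bop \<Rightarrow> bop" where
  "star_bop T = (THE S. is_adjoint T S)"
instance ..
end

lemma cinner_zero_left [simp]: "cinner 0 y = 0" by (simp add: cinner_def)
lemma cinner_zero_right [simp]: "cinner x 0 = 0" by (simp add: cinner_def)

lemma cinner_sum_left: "cinner (\<Sum>i\<in>I. f i) y = (\<Sum>i\<in>I. cinner (f i) y)"
  by (induction I rule: infinite_finite_induct) (auto simp: cinner_add_left)

lemma ell2_coeff_sum: "ell2_coeff (\<Sum>i\<in>I. f i) n = (\<Sum>i\<in>I. ell2_coeff (f i) n)"
  by (induction I rule: infinite_finite_induct) auto

lift_definition ell2_basis :: "nat \<Rightarrow> ell2" is "\<lambda>n k. if k = n then 1 else 0"
  subgoal for n by (rule summable_finite[of "{n}"]) auto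
  done

lemma ell2_coeff_trunc:
  "ell2_coeff (\<Sum>n<N. c n *\<^sub>C ell2_basis n) k = (if k < N then c k else 0)"
  by (simp add: ell2_coeff_sum ell2_basis.rep_eq if_distrib[of "(*) _"] sum.delta cong: if_cong)

lemma norm_ell2_trunc: "(norm (\<Sum>n<N. c n *\<^sub>C ell2_basis n))\<^sup>2 = (\<Sum>n<N. (cmod (c n))\<^sup>2)"
  unfolding norm_ell2_sq ell2_coeff_trunc
  by (subst suminf_finite[of "{..<N}"]) auto

lemma ell2_trunc_tendsto: "(\<lambda>N. \<Sum>n<N. ell2_coeff x n *\<^sub>C ell2_basis n) \<longlonglongrightarrow> x"
proof -
  have sq: "(norm ((\<Sum>n<N. ell2_coeff x n *\<^sub>C ell2_basis n) - x))\<^sup>2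
      = (norm x)\<^sup>2 - (\<Sum>n<N. (cmod (ell2_coeff x n))\<^sup>2)" for N
  proof -
    let ?d = "\<lambda>n. (cmod (ell2_coeff ((\<Sum>n<N. ell2_coeff x n *\<^sub>C ell2_basis n) - x) n))\<^sup>2"
    have "(\<Sum>n. ?d n) = (\<Sum>n. ?d (n + N)) + (\<Sum>n<N. ?d n)"
      by (rule suminf_split_initial_segment[OF summable_ell2])
    also have "(\<Sum>n<N. ?d n) = 0" by (simp add: ell2_coeff_trunc)
    also have "(\<Sum>n. ?d (n + N)) = (\<Sum>n. (cmod (ell2_coeff x (n + N)))\<^sup>2)"
      by (simp add: ell2_coeff_trunc)
    finally show ?thesis
      unfolding norm_ell2_sq using suminf_split_initial_segment[OF summable_ell2, of x N] by simp
  qed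
  have "(\<lambda>N. (norm x)\<^sup>2 - (\<Sum>n<N. (cmod (ell2_coeff x n))\<^sup>2)) \<longlonglongrightarrow> (norm x)\<^sup>2 - (norm x)\<^sup>2"
    unfolding norm_ell2_sq by (intro tendsto_intros summable_LIMSEQ summable_ell2)
  then have "(\<lambda>N. (norm ((\<Sum>n<N. ell2_coeff x n *\<^sub>C ell2_basis n) - x))\<^sup>2) \<longlonglongrightarrow> 0"
    by (simp add: sq)
  from tendsto_real_sqrt[OF this]
  have "(\<lambda>N. norm ((\<Sum>n<N. ell2_coeff x n *\<^sub>C ell2_basis n) - x)) \<longlonglongrightarrow> 0"
    by simp
  then show ?thesis
    using LIM_zero_cancel tendsto_norm_zero_iff by blast
qed

lemma bop_apply_sum: "bop_apply T (\<Sum>i\<in>I. f i) = (\<Sum>i\<in>I. bop_apply T (f i))"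
  by (rule linear_sum) (simp add: bounded_linear.linear bounded_linear_bop_apply)

lemma tendsto_cinner_left: "(f \<longlongrightarrow> x) F \<Longrightarrow> ((\<lambda>n. cinner (f n) y) \<longlongrightarrow> cinner x y) F"
proof -
  have "cinner (r *\<^sub>R x) y = r *\<^sub>R cinner x y" for r x
  proof -
    have "r *\<^sub>R x = complex_of_real r *\<^sub>C x" by (rule ell2_eqI) simp
    then show ?thesis by (simp add: cinner_scaleC_left scaleR_conv_of_real)
  qed
  then have "bounded_linear (\<lambda>x. cinner x y)"
    by (intro bounded_linear_intro[where K = "norm y"]) (auto simp: cinner_add_left norm_cinner_le)
  then show "(f \<longlongrightarrow> x) F \<Longrightarrow> ?thesis" by (rule bounded_linear.tendsto)
qed

lemma is_adjoint_unique: "is_adjoint T S \<Longrightarrow> is_adjoint T S' \<Longrightarrow> S = S'"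
  unfolding is_adjoint_def by (metis bop_eqI cinner_eqI)

lemma is_adjoint_exists: "\<exists>S. is_adjoint T S"
proof -
  have "\<exists>z. \<forall>x. cinner (bop_apply T x) y = cinner x z" for y
  proof -
    define c where "c n = cinner (bop_apply T (ell2_basis n)) y" for n
    have T_trunc: "cinner (bop_apply T (\<Sum>n<N. a n *\<^sub>C ell2_basis n)) y = (\<Sum>n<N. cnj (a n) * c n)" for a N
      by (simp add: bop_apply_sum bop_apply_scaleC cinner_sum_left cinner_scaleC_left c_def)
    have bound: "(\<Sum>n<N. (cmod (c n))\<^sup>2) \<le> (norm T * norm y)\<^sup>2" for N
    proof -
      define z where "z = (\<Sum>n<N. c n *\<^sub>C ell2_basis n)"
      have nz: "(norm z)\<^sup>2 = (\<Sum>n<N. (cmod (c n))\<^sup>2)"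
        unfolding z_def by (rule norm_ell2_trunc)
      have "cinner (bop_apply T z) y = complex_of_real ((norm z)\<^sup>2)"
        unfolding nz
        by (simp only: z_def T_trunc of_real_sum complex_norm_square mult.commute[of "cnj _"])
      then have "(norm z)\<^sup>2 \<le> norm (bop_apply T z) * norm y"
        using norm_cinner_le[of "bop_apply T z" y] by (simp add: norm_power)
      also have "\<dots> \<le> norm T * norm z * norm y"
        by (intro mult_right_mono norm_bop_apply) simp
      finally have "norm z * norm z \<le> norm z * (norm T * norm y)"
        by (simp add: power2_eq_square mult_ac)
      then have "norm z \<le> norm T * norm y"
        by (cases "z = 0") auto
      then show ?thesis by (simp flip: nz add: power_mono)
    qed
    then have "summable (\<lambda>n. (cmod (c n))\<^sup>2)"
      by (intro summableI_nonneg_bounded) auto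
    then have Sc: "ell2_coeff (Abs_ell2 c) = c" by (simp add: Abs_ell2_inverse)
    have "cinner (bop_apply T x) y = cinner x (Abs_ell2 c)" for x
    proof (rule LIMSEQ_unique)
      show "(\<lambda>N. \<Sum>n<N. cnj (ell2_coeff x n) * c n) \<longlonglongrightarrow> cinner x (Abs_ell2 c)"
        using summable_LIMSEQ[OF summable_cinner, of x "Abs_ell2 c"] by (simp add: cinner_def Sc)
      show "(\<lambda>N. \<Sum>n<N. cnj (ell2_coeff x n) * c n) \<longlonglongrightarrow> cinner (bop_apply T x) y"
        unfolding T_trunc[symmetric]
        by (intro tendsto_cinner_left bounded_linear.tendsto[OF bounded_linear_bop_apply] ell2_trunc_tendsto)
    qed
    then show ?thesis by blast
  qed
  then obtain f where f: "\<And>x y. cinner (bop_apply T x) y = cinner x (f y)" by metis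
  have "\<exists>S. bop_apply S = f"
  proof (rule bopI)
    show "f (x + y) = f x + f y" for x y
      by (rule cinner_eqI) (simp add: cinner_add_right flip: f)
    show "f (c *\<^sub>C x) = c *\<^sub>C f x" for c x
      by (rule cinner_eqI) (simp add: cinner_scaleC_right flip: f)
    show "norm (f y) \<le> norm y * norm T" for y
    proof -
      have "(norm (f y))\<^sup>2 = cmod (cinner (bop_apply T (f y)) y)"
        by (simp add: f cinner_self_norm norm_power)
      also have "\<dots> \<le> norm (bop_apply T (f y)) * norm y" by (rule norm_cinner_le)
      also have "\<dots> \<le> norm T * norm (f y) * norm y"
        by (intro mult_right_mono norm_bop_apply) simp
      finally have "norm (f y) * norm (f y) \<le> norm (f y) * (norm y * norm T)"
        by (simp add: power2_eq_square mult_ac)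
      then show ?thesis by (cases "f y = 0") auto
    qed
  qed
  then show ?thesis by (auto simp: is_adjoint_def f)
qed

lemma cinner_star: "cinner (bop_apply T x) y = cinner x (bop_apply (star T) y)"
proof -
  have "is_adjoint T (star T)"
    unfolding star_bop_def using is_adjoint_exists is_adjoint_unique by (metis theI)
  then show ?thesis by (simp add: is_adjoint_def)
qed

lemma star_bop_eqI: "(\<And>x y. cinner (bop_apply T x) y = cinner x (bop_apply S y)) \<Longrightarrow> star T = S"
  by (metis cinner_star is_adjoint_def is_adjoint_unique)

lemma cinner_star': "cinner (bop_apply (star T) x) y = cinner x (bop_apply T y)"
  by (metis cinner_commute cinner_star)

instance bop :: cstar_algebra
proof
  fix x y :: bop and c d :: complex and r :: real
  show "c *\<^sub>C (x + y) = c *\<^sub>C x + c *\<^sub>C y"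
    by (intro bop_eqI ell2_eqI) (simp add: algebra_simps)
  show "(c + d) *\<^sub>C x = c *\<^sub>C x + d *\<^sub>C x"
    by (intro bop_eqI ell2_eqI) (simp add: algebra_simps)
  show "c *\<^sub>C d *\<^sub>C x = (c * d) *\<^sub>C x"
    by (intro bop_eqI ell2_eqI) (simp add: algebra_simps)
  show "r *\<^sub>R x = complex_of_real r *\<^sub>C x"
    by (intro bop_eqI ell2_eqI) (simp add: algebra_simps)
  show "(c *\<^sub>C x) * y = c *\<^sub>C (x * y)" by (intro bop_eqI) simp
  show "x * (c *\<^sub>C y) = c *\<^sub>C (x * y)" by (intro bop_eqI) (simp add: bop_apply_scaleC)
  have le: "norm (d *\<^sub>C z) \<le> cmod d * norm z" for d and z :: bop
    by (rule norm_bop_le)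
       (auto simp: norm_scaleC_ell2 mult.assoc intro!: mult_left_mono norm_bop_apply)
  show "norm (c *\<^sub>C x) = cmod c * norm x"
  proof (cases "c = 0")
    case True
    then show ?thesis using le[of c x] by simp
  next
    case False
    have "inverse c *\<^sub>C c *\<^sub>C x = x"
      using False by (intro bop_eqI ell2_eqI) simp
    then have "norm x \<le> inverse (cmod c) * norm (c *\<^sub>C x)"
      using le[of "inverse c" "c *\<^sub>C x"] by (simp add: norm_inverse)
    then have "cmod c * norm x \<le> norm (c *\<^sub>C x)"
      using False by (simp add: field_simps)
    then show ?thesis using le[of c x] by simp
  qed
  show "star (star x) = x" by (rule star_bop_eqI) (rule cinner_star')
  show "star (x + y) = star x + star y"
    by (rule star_bop_eqI) (simp add: cinner_add_left cinner_add_right cinner_star)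
  show "star (c *\<^sub>C x) = cnj c *\<^sub>C star x"
    by (rule star_bop_eqI) (simp add: cinner_scaleC_left cinner_scaleC_right cinner_star)
  show "star (x * y) = star y * star x"
    by (rule star_bop_eqI) (simp add: cinner_star)
  have sq: "(norm (bop_apply x v))\<^sup>2 \<le> norm (star x * x) * (norm v)\<^sup>2" for x v
  proof -
    have "(norm (bop_apply x v))\<^sup>2 = cmod (cinner v (bop_apply (star x * x) v))"
      using cinner_star[of x v "bop_apply x v", symmetric]
      by (simp add: cinner_self_norm norm_power)
    also have "\<dots> \<le> norm v * norm (bop_apply (star x * x) v)" by (rule norm_cinner_le)
    also have "\<dots> \<le> norm v * (norm (star x * x) * norm v)"
      by (intro mult_left_mono norm_bop_apply) simp
    finally show ?thesis by (simp add: power2_eq_square mult_ac)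
  qed
  have ge: "(norm x)\<^sup>2 \<le> norm (star x * x)" for x :: bop
  proof -
    have "norm x \<le> sqrt (norm (star x * x))"
    proof (rule norm_bop_le)
      fix v
      show "norm (bop_apply x v) \<le> sqrt (norm (star x * x)) * norm v"
        using real_sqrt_le_mono[OF sq[of x v]] by (simp add: real_sqrt_mult)
    qed simp
    then show ?thesis
      using power_mono[of "norm x" "sqrt (norm (star x * x))" 2] by simp
  qed
  have star_le: "norm (star x) \<ge> norm x" for x :: bop
  proof -
    have "norm x * norm x \<le> norm (star x) * norm x"
      using order_trans[OF ge norm_mult_ineq, of x] by (simp add: power2_eq_square)
    then show ?thesis by (cases "x = 0") auto
  qed
  have "norm (star x) = norm x"
    using star_le[of x] star_le[of "star x"] \<open>star (star x) = x\<close> by simp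
  then show "norm (star x * x) = (norm x)\<^sup>2"
    using ge[of x] norm_mult_ineq[of "star x" x] by (simp add: power2_eq_square)
qed


section \<open>Bounded continuous functions into a \<open>C\<^sup>*\<close>-algebra\<close>

lemma star_zero [simp]: "star (0 :: 'a::cstar_algebra) = 0"
  using star_add[of 0 "0 :: 'a"] by simp

lemma norm_star [simp]: "norm (star (x :: 'a::cstar_algebra)) = norm x"
proof -
  have le: "norm x \<le> norm (star x)" for x :: 'a
  proof (cases "x = 0")
    case False
    have "norm x * norm x \<le> norm (star x) * norm x"
      using norm_mult_ineq[of "star x" x] by (simp add: cstar_identity power2_eq_square)
    then show ?thesis using False by simp
  qed simp
  show ?thesis using le[of x] le[of "star x"] by (simp add: star_star)
qed

lemma bounded_linear_scaleC: "bounded_linear (\<lambda>x :: 'a::cstar_algebra. c *\<^sub>C x)"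
  by (rule bounded_linear_intro[where K = "cmod c"])
     (auto simp: scaleC_add_right scaleR_scaleC scaleC_scaleC norm_scaleC mult.commute)

lemma bounded_linear_star: "bounded_linear (star :: 'a::cstar_algebra \<Rightarrow> 'a)"
  by (rule bounded_linear_intro[where K = 1]) (auto simp: star_add scaleR_scaleC star_scaleC)

instantiation bcontfun :: (metric_space, cstar_algebra) cstar_algebra
begin

definition times_bcontfun :: "('a \<Rightarrow>\<^sub>C 'b) \<Rightarrow> ('a \<Rightarrow>\<^sub>C 'b) \<Rightarrow> 'a \<Rightarrow>\<^sub>C 'b" where
  "f * g = Bcontfun (\<lambda>x. apply_bcontfun f x * apply_bcontfun g x)"
definition scaleC_bcontfun :: "complex \<Rightarrow> ('a \<Rightarrow>\<^sub>C 'b) \<Rightarrow> 'a \<Rightarrow>\<^sub>C 'b" where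
  "c *\<^sub>C f = Bcontfun (\<lambda>x. c *\<^sub>C apply_bcontfun f x)"
definition star_bcontfun :: "('a \<Rightarrow>\<^sub>C 'b) \<Rightarrow> 'a \<Rightarrow>\<^sub>C 'b" where
  "star f = Bcontfun (\<lambda>x. star (apply_bcontfun f x))"

lemma times_bcontfun_apply: "apply_bcontfun (f * g) x = apply_bcontfun f x * apply_bcontfun g x"
  for f g :: "'a \<Rightarrow>\<^sub>C 'b"
proof -
  have "(\<lambda>x. apply_bcontfun f x * apply_bcontfun g x) \<in> bcontfun"
    by (rule bcontfun_normI[where b = "norm f * norm g"])
       (auto intro!: continuous_intros order_trans[OF norm_mult_ineq] mult_mono norm_bounded)
  then show ?thesis by (simp add: times_bcontfun_def Bcontfun_inverse)
qed

lemma scaleC_bcontfun_apply: "apply_bcontfun (c *\<^sub>C f) x = c *\<^sub>C apply_bcontfun f x"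
  for f :: "'a \<Rightarrow>\<^sub>C 'b"
proof -
  have "(\<lambda>x. c *\<^sub>C apply_bcontfun f x) \<in> bcontfun"
    by (rule bcontfun_normI[where b = "cmod c * norm f"])
       (auto intro!: bounded_linear.continuous_on[OF bounded_linear_scaleC] mult_left_mono norm_bounded
         simp: norm_scaleC)
  then show ?thesis by (simp add: scaleC_bcontfun_def Bcontfun_inverse)
qed

lemma star_bcontfun_apply: "apply_bcontfun (star f) x = star (apply_bcontfun f x)"
  for f :: "'a \<Rightarrow>\<^sub>C 'b"
proof -
  have "(\<lambda>x. star (apply_bcontfun f x)) \<in> bcontfun"
    by (rule bcontfun_normI[where b = "norm f"])
       (auto intro!: bounded_linear.continuous_on[OF bounded_linear_star] norm_bounded)
  then show ?thesis by (simp add: star_bcontfun_def Bcontfun_inverse)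
qed

lemmas bcontfun_apply_simps = times_bcontfun_apply scaleC_bcontfun_apply star_bcontfun_apply

instance
proof
  fix f g h :: "'a \<Rightarrow>\<^sub>C 'b" and c d :: complex and r :: real
  show "f * g * h = f * (g * h)"
    by (rule bcontfun_eqI) (simp add: bcontfun_apply_simps mult.assoc)
  show "(f + g) * h = f * h + g * h"
    by (rule bcontfun_eqI) (simp add: bcontfun_apply_simps distrib_right)
  show "f * (g + h) = f * g + f * h"
    by (rule bcontfun_eqI) (simp add: bcontfun_apply_simps distrib_left)
  show "r *\<^sub>R f * g = r *\<^sub>R (f * g)" "f * r *\<^sub>R g = r *\<^sub>R (f * g)"
    by (rule bcontfun_eqI, simp add: bcontfun_apply_simps)+
  show norm_mult: "norm (f * g) \<le> norm f * norm g" for f g :: "'a \<Rightarrow>\<^sub>C 'b"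
    by (rule norm_bound)
       (auto simp: bcontfun_apply_simps intro!: order_trans[OF norm_mult_ineq] mult_mono norm_bounded)
  show "c *\<^sub>C (f + g) = c *\<^sub>C f + c *\<^sub>C g"
    by (rule bcontfun_eqI) (simp add: bcontfun_apply_simps scaleC_add_right)
  show "(c + d) *\<^sub>C f = c *\<^sub>C f + d *\<^sub>C f"
    by (rule bcontfun_eqI) (simp add: bcontfun_apply_simps scaleC_add_left)
  show scaleC_scaleC: "c *\<^sub>C d *\<^sub>C f = (c * d) *\<^sub>C f" for c d and f :: "'a \<Rightarrow>\<^sub>C 'b"
    by (rule bcontfun_eqI) (simp add: bcontfun_apply_simps cstar_algebra_class.scaleC_scaleC)
  show scaleR_scaleC: "r *\<^sub>R f = complex_of_real r *\<^sub>C f" for r and f :: "'a \<Rightarrow>\<^sub>C 'b"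
    by (rule bcontfun_eqI) (simp add: bcontfun_apply_simps cstar_algebra_class.scaleR_scaleC)
  have le: "norm (d *\<^sub>C k) \<le> cmod d * norm k" for d and k :: "'a \<Rightarrow>\<^sub>C 'b"
    by (rule norm_bound) (auto simp: bcontfun_apply_simps norm_scaleC intro!: mult_left_mono norm_bounded)
  show "norm (c *\<^sub>C f) = cmod c * norm f"
  proof (cases "c = 0")
    case True
    then show ?thesis using le[of c f] by simp
  next
    case False
    have "inverse c *\<^sub>C c *\<^sub>C f = f"
      using False scaleR_scaleC[of 1 f] by (simp add: scaleC_scaleC)
    then have "norm f \<le> inverse (cmod c) * norm (c *\<^sub>C f)"
      using le[of "inverse c" "c *\<^sub>C f"] by (simp add: norm_inverse)
    then have "cmod c * norm f \<le> norm (c *\<^sub>C f)"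
      using False by (simp add: field_simps)
    then show ?thesis using le[of c f] by simp
  qed
  show "(c *\<^sub>C f) * g = c *\<^sub>C (f * g)"
    by (rule bcontfun_eqI) (simp add: bcontfun_apply_simps scaleC_mult_left)
  show "f * (c *\<^sub>C g) = c *\<^sub>C (f * g)"
    by (rule bcontfun_eqI) (simp add: bcontfun_apply_simps scaleC_mult_right)
  show "star (star f) = f"
    by (rule bcontfun_eqI) (simp add: bcontfun_apply_simps star_star)
  show "star (f + g) = star f + star g"
    by (rule bcontfun_eqI) (simp add: bcontfun_apply_simps star_add)
  show "star (c *\<^sub>C f) = cnj c *\<^sub>C star f"
    by (rule bcontfun_eqI) (simp add: bcontfun_apply_simps star_scaleC)
  show "star (f * g) = star g * star f"
    by (rule bcontfun_eqI) (simp add: bcontfun_apply_simps star_mult)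
  have "norm (star f) \<le> norm f"
    by (rule norm_bound) (simp add: bcontfun_apply_simps norm_bounded)
  then have "norm (star f) * norm f \<le> norm f * norm f" by (rule mult_right_mono) simp
  then have "norm (star f * f) \<le> (norm f)\<^sup>2"
    using norm_mult[of "star f" f] by (simp add: power2_eq_square)
  moreover have "norm f \<le> sqrt (norm (star f * f))"
  proof (rule norm_bound)
    fix x
    have "(norm (apply_bcontfun f x))\<^sup>2 = norm (apply_bcontfun (star f * f) x)"
      by (simp add: bcontfun_apply_simps cstar_identity)
    also have "\<dots> \<le> norm (star f * f)" by (rule norm_bounded)
    finally show "norm (apply_bcontfun f x) \<le> sqrt (norm (star f * f))"
      by (rule real_le_rsqrt)
  qed
  then have "(norm f)\<^sup>2 \<le> norm (star f * f)"
    using power_mono[of "norm f" "sqrt (norm (star f * f))" 2] by simp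
  ultimately show "norm (star f * f) = (norm f)\<^sup>2" by simp
qed

end


section \<open>Hypergraphs and their \<open>C\<^sup>*\<close>-algebras\<close>

record ('v, 'e) hypergraph =
  verts :: "'v set"
  edges :: "'e set"
  range_of :: "'e \<Rightarrow> 'v set"
  source_of :: "'e \<Rightarrow> 'v set"

definition finite_hypergraph :: "('v, 'e) hypergraph \<Rightarrow> bool" where
  "finite_hypergraph H \<longleftrightarrow> finite (verts H) \<and> finite (edges H) \<and>
     (\<forall>e\<in>edges H. range_of H e \<subseteq> verts H \<and> range_of H e \<noteq> {} \<and>
                   source_of H e \<subseteq> verts H \<and> source_of H e \<noteq> {})"

definition is_sink :: "('v, 'e) hypergraph \<Rightarrow> 'v \<Rightarrow> bool" where
  "is_sink H v \<longleftrightarrow> (\<forall>e\<in>edges H. v \<notin> source_of H e)"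

definition is_source :: "('v, 'e) hypergraph \<Rightarrow> 'v \<Rightarrow> bool" where
  "is_source H v \<longleftrightarrow> (\<forall>e\<in>edges H. v \<notin> range_of H e)"

definition locally_ultra :: "('v, 'e) hypergraph \<Rightarrow> 'v \<Rightarrow> bool" where
  "locally_ultra H w \<longleftrightarrow> (\<forall>e\<in>edges H. w \<in> source_of H e \<longrightarrow> source_of H e = {w})"

definition move_S :: "('v, 'e) hypergraph \<Rightarrow> 'v \<Rightarrow> ('v, 'e) hypergraph" where
  "move_S H w = \<lparr>verts = verts H - {w}, edges = edges H - {e \<in> edges H. w \<in> source_of H e},
     range_of = range_of H, source_of = source_of H\<rparr>"

definition hypergraph_family ::
  "('v, 'e) hypergraph \<Rightarrow> ('v \<Rightarrow> 'a::cstar_algebra) \<Rightarrow> ('e \<Rightarrow> 'a) \<Rightarrow> bool" where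
  "hypergraph_family H p s \<longleftrightarrow>
     (\<forall>v\<in>verts H. projection (p v)) \<and>
     (\<forall>v\<in>verts H. \<forall>w\<in>verts H. v \<noteq> w \<longrightarrow> p v * p w = 0) \<and>
     (\<forall>e\<in>edges H. partial_isometry (s e)) \<and>
     (\<forall>e\<in>edges H. \<forall>f\<in>edges H.
        star (s e) * s f = (if e = f then \<Sum>v\<in>range_of H e. p v else 0)) \<and>
     (\<forall>e\<in>edges H. s e * star (s e) \<sqsubseteq> (\<Sum>v\<in>source_of H e. p v)) \<and>
     (\<forall>v\<in>verts H. \<not> is_sink H v \<longrightarrow>
        p v \<sqsubseteq> (\<Sum>e\<in>{e \<in> edges H. v \<in> source_of H e}. s e * star (s e)))"

text \<open>
  The universal \<open>C\<^sup>*\<close>-algebra is the completion of the free \<open>*\<close>-algebra on the generators, modulo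
  null elements, in the seminorm \<open>\<parallel>x\<parallel> = sup\<^sub>\<rho> \<parallel>\<rho>(x)\<parallel>\<close>, where \<open>\<rho>\<close> runs over the representations of
  the relations by operators on Hilbert spaces. Equivalently, it is the \<open>C\<^sup>*\<close>-algebra generated by
  \<open>(\<rho>(p\<^sub>v))\<^sub>\<rho>\<close> and \<open>(\<rho>(s\<^sub>e))\<^sub>\<rho>\<close> in the \<open>\<ell>\<^sup>\<infinity>\<close>-product of the operator algebras of all \<open>\<rho>\<close>, and this
  is the form used here. Representations on \<open>\<ell>\<^sup>2(\<nat>)\<close> suffice: a \<open>C\<^sup>*\<close>-algebra generated by finitely
  many elements is separable, hence it embeds into the operators on \<open>\<ell>\<^sup>2(\<nat>)\<close>; the embedding is not
  required to be unital.

  The index type consists of all pairs of functions. The discrete topology makes every bounded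
  function on it an element of the \<open>\<ell>\<^sup>\<infinity>\<close>-product, and pairs that are not representations of the
  relations are given the value \<open>0\<close>.
\<close>

type_synonym ('v, 'e) rep_product = "(('v \<Rightarrow> bop) \<times> ('e \<Rightarrow> bop)) discrete \<Rightarrow>\<^sub>C bop"

definition univ_proj :: "('v, 'e) hypergraph \<Rightarrow> 'v \<Rightarrow> ('v, 'e) rep_product" where
  "univ_proj H v = Bcontfun (\<lambda>\<rho>. case of_discrete \<rho> of (p, s) \<Rightarrow>
     if hypergraph_family H p s then p v else 0)"

definition univ_piso :: "('v, 'e) hypergraph \<Rightarrow> 'e \<Rightarrow> ('v, 'e) rep_product" where
  "univ_piso H e = Bcontfun (\<lambda>\<rho>. case of_discrete \<rho> of (p, s) \<Rightarrow>
     if hypergraph_family H p s then s e else 0)"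

definition hypergraph_cstar :: "('v, 'e) hypergraph \<Rightarrow> ('v, 'e) rep_product set" where
  "hypergraph_cstar H = cstar_generated (univ_proj H ` verts H \<union> univ_piso H ` edges H)"

lemma cstar_subalgebra_generated: "cstar_subalgebra (cstar_generated G)"
proof -
  have "closed (cstar_generated G)"
    unfolding cstar_generated_def by (rule closed_Inter) (simp add: cstar_subalgebra_def)
  then show ?thesis
    unfolding cstar_subalgebra_def[of "cstar_generated G"]
    by (simp add: cstar_generated_def cstar_subalgebra_def)
qed

lemma cstar_generated_superset: "G \<subseteq> cstar_generated G"
  unfolding cstar_generated_def by auto

lemma projection_zero [simp]: "projection (0 :: 'a::cstar_algebra)"
  by (simp add: projection_def)

lemma partial_isometry_zero [simp]: "partial_isometry (0 :: 'a::cstar_algebra)"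
  by (simp add: partial_isometry_def)

lemma norm_projection_le: "projection (p :: 'a::cstar_algebra) \<Longrightarrow> norm p \<le> 1"
proof -
  assume "projection p"
  then have "star p * p = p" by (simp only: projection_def)
  then have "norm p = norm p * norm p"
    using cstar_identity[of p] by (simp only: power2_eq_square)
  then have "norm p = 0 \<or> norm p = 1"
    by (metis mult_cancel_left2)
  then show "norm p \<le> 1" by linarith
qed

lemma norm_partial_isometry_le: "partial_isometry (s :: 'a::cstar_algebra) \<Longrightarrow> norm s \<le> 1"
proof -
  assume "partial_isometry s"
  then have "projection (star s * s)"
    by (simp add: partial_isometry_def projection_def star_mult star_star mult.assoc)
  from norm_projection_le[OF this] have "(norm s)\<^sup>2 \<le> 1\<^sup>2" by (simp add: cstar_identity)
  then show "norm s \<le> 1" by (rule power2_le_imp_le) simp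
qed

lemma discrete_bcontfun:
  fixes f :: "'i discrete \<Rightarrow> 'a::real_normed_vector"
  assumes "\<And>x. norm (f x) \<le> b"
  shows "f \<in> bcontfun"
  using assms
  by (intro bcontfun_normI[where b = b]) (auto simp: continuous_on_open_vimage open_discrete)

lemma univ_proj_apply:
  assumes "v \<in> verts H"
  shows "apply_bcontfun (univ_proj H v) (discrete (p, s)) = (if hypergraph_family H p s then p v else 0)"
  unfolding univ_proj_def using assms
  by (subst Bcontfun_inverse)
     (auto intro!: discrete_bcontfun[where b = 1] norm_projection_le
       simp: discrete_inverse hypergraph_family_def split: prod.splits)

lemma univ_piso_apply:
  assumes "e \<in> edges H"
  shows "apply_bcontfun (univ_piso H e) (discrete (p, s)) = (if hypergraph_family H p s then s e else 0)"
  unfolding univ_piso_def using assms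
  by (subst Bcontfun_inverse)
     (auto intro!: discrete_bcontfun[where b = 1] norm_partial_isometry_le
       simp: discrete_inverse hypergraph_family_def split: prod.splits)

lemma sum_bcontfun_apply:
  "apply_bcontfun (\<Sum>i\<in>I. f i) x = (\<Sum>i\<in>I. apply_bcontfun (f i) x)"
  for f :: "'i \<Rightarrow> ('a::topological_space \<Rightarrow>\<^sub>C 'b::real_normed_vector)"
  by (induction I rule: infinite_finite_induct) auto

lemma discrete_bcontfun_eqI:
  fixes f g :: "('v, 'e) rep_product"
  shows "(\<And>p s. apply_bcontfun f (discrete (p, s)) = apply_bcontfun g (discrete (p, s))) \<Longrightarrow> f = g"
  by (rule bcontfun_eqI) (metis of_discrete_inverse surj_pair)

lemma cstar_le_bcontfunI:
  fixes f g :: "'i discrete \<Rightarrow>\<^sub>C 'a::cstar_algebra"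
  assumes "\<And>x. apply_bcontfun f x \<sqsubseteq> apply_bcontfun g x"
  shows "f \<sqsubseteq> g"
proof -
  obtain z where z: "\<And>x. apply_bcontfun g x - apply_bcontfun f x = star (z x) * z x"
    using assms unfolding cstar_le_def by metis
  have "norm (z x) \<le> sqrt (norm (g - f))" for x
    using norm_bounded[of "g - f" x] by (intro real_le_rsqrt) (simp add: z cstar_identity)
  then have "z \<in> bcontfun" by (rule discrete_bcontfun)
  then have "apply_bcontfun (Bcontfun z) = z" by (simp add: Bcontfun_inverse)
  then have "g - f = star (Bcontfun z) * Bcontfun z"
    by (intro bcontfun_eqI) (simp add: bcontfun_apply_simps z)
  then show ?thesis unfolding cstar_le_def by blast
qed

lemma hypergraph_familyD:
  assumes "hypergraph_family H p s"
  shows "v \<in> verts H \<Longrightarrow> projection (p v)"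
    and "v \<in> verts H \<Longrightarrow> w \<in> verts H \<Longrightarrow> v \<noteq> w \<Longrightarrow> p v * p w = 0"
    and "e \<in> edges H \<Longrightarrow> partial_isometry (s e)"
    and "e \<in> edges H \<Longrightarrow> f \<in> edges H \<Longrightarrow>
      star (s e) * s f = (if e = f then \<Sum>v\<in>range_of H e. p v else 0)"
    and "e \<in> edges H \<Longrightarrow> s e * star (s e) \<sqsubseteq> (\<Sum>v\<in>source_of H e. p v)"
    and "v \<in> verts H \<Longrightarrow> \<not> is_sink H v \<Longrightarrow>
      p v \<sqsubseteq> (\<Sum>e\<in>{e \<in> edges H. v \<in> source_of H e}. s e * star (s e))"
proof -
  note * = assms[unfolded hypergraph_family_def]
  note 1 = *[THEN conjunct1] *[THEN conjunct2, THEN conjunct1]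
    *[THEN conjunct2, THEN conjunct2, THEN conjunct1]
    *[THEN conjunct2, THEN conjunct2, THEN conjunct2, THEN conjunct1]
    *[THEN conjunct2, THEN conjunct2, THEN conjunct2, THEN conjunct2, THEN conjunct1]
    *[THEN conjunct2, THEN conjunct2, THEN conjunct2, THEN conjunct2, THEN conjunct2]
  show "v \<in> verts H \<Longrightarrow> projection (p v)" by (rule 1(1)[rule_format])
  show "v \<in> verts H \<Longrightarrow> w \<in> verts H \<Longrightarrow> v \<noteq> w \<Longrightarrow> p v * p w = 0"
    by (rule 1(2)[rule_format])
  show "e \<in> edges H \<Longrightarrow> partial_isometry (s e)" by (rule 1(3)[rule_format])
  show "e \<in> edges H \<Longrightarrow> f \<in> edges H \<Longrightarrow>
      star (s e) * s f = (if e = f then \<Sum>v\<in>range_of H e. p v else 0)"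
    by (rule 1(4)[THEN bspec, THEN bspec])
  show "e \<in> edges H \<Longrightarrow> s e * star (s e) \<sqsubseteq> (\<Sum>v\<in>source_of H e. p v)"
    by (rule 1(5)[THEN bspec])
  show "v \<in> verts H \<Longrightarrow> \<not> is_sink H v \<Longrightarrow>
      p v \<sqsubseteq> (\<Sum>e\<in>{e \<in> edges H. v \<in> source_of H e}. s e * star (s e))"
    by (rule 1(6)[THEN bspec, THEN mp])
qed

theorem hypergraph_family_univ:
  assumes "finite_hypergraph H"
  shows "hypergraph_family H (univ_proj H) (univ_piso H)"
proof -
  note app = bcontfun_apply_simps sum_bcontfun_apply
  have le: "f \<sqsubseteq> g"
    if fg: "\<And>p s. apply_bcontfun f (discrete (p, s)) \<sqsubseteq> apply_bcontfun g (discrete (p, s))"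
    for f g :: "('a, 'b) rep_product"
  proof (rule cstar_le_bcontfunI)
    fix x :: "(('a \<Rightarrow> bop) \<times> ('b \<Rightarrow> bop)) discrete"
    obtain p s where "of_discrete x = (p, s)" by (cases "of_discrete x")
    then have "x = discrete (p, s)" by (metis of_discrete_inverse)
    then show "apply_bcontfun f x \<sqsubseteq> apply_bcontfun g x" using fg by simp
  qed
  have sub: "v \<in> verts H" if "e \<in> edges H" "v \<in> range_of H e \<or> v \<in> source_of H e" for e v
    using assms that unfolding finite_hypergraph_def by blast
  let ?F = "hypergraph_family H"
  have zero: "(0 :: bop) \<sqsubseteq> 0" unfolding cstar_le_def by (rule exI[of _ 0]) simp
  have sums: "(\<Sum>v\<in>range_of H e. apply_bcontfun (univ_proj H v) (discrete (p, s))) =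
        (if ?F p s then \<Sum>v\<in>range_of H e. p v else 0)"
      "(\<Sum>v\<in>source_of H e. apply_bcontfun (univ_proj H v) (discrete (p, s))) =
        (if ?F p s then \<Sum>v\<in>source_of H e. p v else 0)" if "e \<in> edges H" for e p s
    using sub[OF that] by (simp_all add: univ_proj_apply)
  have sums': "(\<Sum>e\<in>{e \<in> edges H. v \<in> source_of H e}.
        apply_bcontfun (univ_piso H e) (discrete (p, s)) * star (apply_bcontfun (univ_piso H e) (discrete (p, s)))) =
        (if ?F p s then \<Sum>e\<in>{e \<in> edges H. v \<in> source_of H e}. s e * star (s e) else 0)" for v p s
    by (simp add: univ_piso_apply)
  show ?thesis
    unfolding hypergraph_family_def
  proof (intro conjI ballI impI)
    fix v assume v: "v \<in> verts H"
    have "apply_bcontfun (star (univ_proj H v)) (discrete (p, s)) = apply_bcontfun (univ_proj H v) (discrete (p, s))"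
      "apply_bcontfun (univ_proj H v * univ_proj H v) (discrete (p, s)) =
        apply_bcontfun (univ_proj H v) (discrete (p, s))" for p s
      using hypergraph_familyD(1)[of H p s v] v
      by (simp_all add: app univ_proj_apply projection_def)
    then show "projection (univ_proj H v)"
      unfolding projection_def by (intro conjI discrete_bcontfun_eqI)
  next
    fix v w assume v: "v \<in> verts H" and w: "w \<in> verts H" and "v \<noteq> w"
    then have "apply_bcontfun (univ_proj H v * univ_proj H w) (discrete (p, s)) =
        apply_bcontfun 0 (discrete (p, s))" for p s
      using hypergraph_familyD(2)[of H p s v w]
      by (simp add: app univ_proj_apply)
    then show "univ_proj H v * univ_proj H w = 0" by (rule discrete_bcontfun_eqI)
  next
    fix v assume v: "v \<in> verts H" "\<not> is_sink H v"
    show "univ_proj H v \<sqsubseteq>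
        (\<Sum>e\<in>{e \<in> edges H. v \<in> source_of H e}. univ_piso H e * star (univ_piso H e))"
    proof (rule le)
      fix p s
      show "apply_bcontfun (univ_proj H v) (discrete (p, s)) \<sqsubseteq> apply_bcontfun
          (\<Sum>e\<in>{e \<in> edges H. v \<in> source_of H e}. univ_piso H e * star (univ_piso H e)) (discrete (p, s))"
        unfolding app sums' univ_proj_apply[OF v(1)]
        using hypergraph_familyD(6)[of H p s v] v zero by presburger
    qed
  next
    fix e assume e: "e \<in> edges H"
    have "apply_bcontfun (univ_piso H e * star (univ_piso H e) * univ_piso H e) (discrete (p, s)) =
        apply_bcontfun (univ_piso H e) (discrete (p, s))" for p s
      using hypergraph_familyD(3)[of H p s e] e
      by (simp add: app univ_piso_apply partial_isometry_def)
    then show "partial_isometry (univ_piso H e)"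
      unfolding partial_isometry_def by (rule discrete_bcontfun_eqI)
    show "univ_piso H e * star (univ_piso H e) \<sqsubseteq> (\<Sum>v\<in>source_of H e. univ_proj H v)"
    proof (rule le)
      fix p s
      show "apply_bcontfun (univ_piso H e * star (univ_piso H e)) (discrete (p, s)) \<sqsubseteq>
          apply_bcontfun (\<Sum>v\<in>source_of H e. univ_proj H v) (discrete (p, s))"
        unfolding app sums[OF e] univ_piso_apply[OF e]
        using hypergraph_familyD(5)[of H p s e] e zero by (cases "?F p s") simp_all
    qed
  next
    fix e f assume e: "e \<in> edges H" and f: "f \<in> edges H"
    have "apply_bcontfun (star (univ_piso H e) * univ_piso H f) (discrete (p, s)) =
        apply_bcontfun (if e = f then \<Sum>v\<in>range_of H e. univ_proj H v else 0) (discrete (p, s))" for p s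
      using hypergraph_familyD(4)[of H p s e f] e f
      by (cases "e = f"; cases "?F p s") (simp_all add: app univ_piso_apply sums)
    then show "star (univ_piso H e) * univ_piso H f =
        (if e = f then \<Sum>v\<in>range_of H e. univ_proj H v else 0)"
      by (rule discrete_bcontfun_eqI)
  qed
qed

theorem hypergraph_cstar_universal:
  assumes "hypergraph_family H p s"
  defines "ev \<equiv> \<lambda>x. apply_bcontfun x (discrete (p, s))"
  shows "star_hom (hypergraph_cstar H) UNIV ev"
    and "\<And>v. v \<in> verts H \<Longrightarrow> ev (univ_proj H v) = p v"
    and "\<And>e. e \<in> edges H \<Longrightarrow> ev (univ_piso H e) = s e"
  using assms(1)
  by (simp_all add: ev_def star_hom_def bcontfun_apply_simps univ_proj_apply univ_piso_apply)

end

theory Submission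
  imports Defs
begin

text \<open>
  Every representation of the relations of \<open>H\<close> is one of those of \<open>move_S H w\<close>, so \<open>\<pi>\<close> restricts an element
  of the product to the representations of \<open>H\<close>. Conversely, up to conjugation by an isometry, every
  representation of the relations of \<open>move_S H w\<close> extends to one of \<open>H\<close>: choose the missing partial
  isometries with mutually orthogonal ranges and let \<open>p\<^sub>w\<close> be the sum of their range projections.
  Hence \<open>\<pi>\<close> is isometric and its image \<open>I\<close> is closed.

  With \<open>\<p> = \<Sum>v\<noteq>w. p\<^sub>v\<close>, local ultraness gives \<open>p\<^sub>w = \<Sum> s\<^sub>e s\<^sub>e\<^sup>*\<close> over the edges \<open>e\<close> emitted by \<open>w\<close>.
  Decomposing the unit accordingly shows that \<open>\<p> x \<p> \<in> I\<close> for all \<open>x\<close>, and, as \<open>s\<^sub>e = s\<^sub>e \<p>\<close>, that a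
  closed ideal that contains \<open>I\<close> contains the unit.
\<close>

section \<open>Generated \<open>C\<^sup>*\<close>-algebras\<close>

text \<open>The elements satisfying \<open>P\<close> form a C*-subalgebra containing
  \<open>G\<close>. The closure steps range over the whole type, so a proof that needs membership in
  the algebra has to put it into \<open>P\<close>.\<close>

lemma cstar_generated_induct [consumes 1, case_names gen closed zero add mult star scale]:
  assumes "x \<in> cstar_generated G"
    and "\<And>x. x \<in> G \<Longrightarrow> P x"
    and "closed {x. P x}"
    and "P 0"
    and "\<And>x y. P x \<Longrightarrow> P y \<Longrightarrow> P (x + y)"
    and "\<And>x y. P x \<Longrightarrow> P y \<Longrightarrow> P (x * y)"
    and "\<And>x. P x \<Longrightarrow> P (star x)"
    and "\<And>c x. P x \<Longrightarrow> P (c *\<^sub>C x)"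
  shows "P x"
proof -
  have "cstar_subalgebra {x. P x}"
    by (simp add: cstar_subalgebra_def assms(3-8))
  with assms(1,2) show ?thesis
    by (auto simp: cstar_generated_def)
qed

lemmas cstar_subalgebraD =
  cstar_subalgebra_def[THEN iffD1, THEN conjunct1]
  cstar_subalgebra_def[THEN iffD1, THEN conjunct2, THEN conjunct1]
  cstar_subalgebra_def[THEN iffD1, THEN conjunct2, THEN conjunct2, THEN conjunct1, rule_format, THEN conjunct1]
  cstar_subalgebra_def[THEN iffD1, THEN conjunct2, THEN conjunct2, THEN conjunct1, rule_format, THEN conjunct2]
  cstar_subalgebra_def[THEN iffD1, THEN conjunct2, THEN conjunct2, THEN conjunct2, rule_format, THEN conjunct1]
  cstar_subalgebra_def[THEN iffD1, THEN conjunct2, THEN conjunct2, THEN conjunct2, rule_format, THEN conjunct2, rule_format]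

lemma cstar_subalgebra_sum:
  assumes "cstar_subalgebra A" "\<And>i. i \<in> I \<Longrightarrow> f i \<in> A"
  shows "sum f I \<in> A"
  using assms(2)
  by (induction I rule: infinite_finite_induct)
     (simp_all add: cstar_subalgebraD(2,3)[OF assms(1)])

lemma star_diff: "star (x - y) = star x - star (y :: 'a::cstar_algebra)"
  by (rule bounded_linear.linear[OF bounded_linear_star, THEN linear_diff])

lemma star_sum: "star (sum f I) = (\<Sum>i\<in>I. star (f i :: 'a::cstar_algebra))"
  by (rule bounded_linear.linear[OF bounded_linear_star, THEN linear_sum])

lemma scaleC_zero [simp]: "c *\<^sub>C (0 :: 'a::cstar_algebra) = 0"
  using norm_scaleC[of c "0 :: 'a"] by simp

text \<open>Absorption turns \<open>a * c\<close> into \<open>a * b * c\<close>. This carries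
  orthogonality over from projections to partial isometries.\<close>

lemma mult_eq_0_if_absorb:
  fixes a b c :: "'a::ring"
  shows "a * b = 0 \<Longrightarrow> b * c = c \<Longrightarrow> a * c = 0"
    and "a * b = a \<Longrightarrow> b * c = 0 \<Longrightarrow> a * c = 0"
  by (metis mult.assoc mult_zero_left mult_zero_right)+

lemma projection_sum:
  fixes p :: "'i \<Rightarrow> 'a::cstar_algebra"
  assumes "\<And>i. i \<in> I \<Longrightarrow> projection (p i)"
    and "\<And>i j. i \<in> I \<Longrightarrow> j \<in> I \<Longrightarrow> i \<noteq> j \<Longrightarrow> p i * p j = 0"
  shows "projection (sum p I)"
proof (cases "finite I")
  case True
  have "(\<Sum>i\<in>I. \<Sum>j\<in>I. p i * p j) = (\<Sum>i\<in>I. \<Sum>j\<in>I. if i = j then p i else 0)"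
    using assms by (intro sum.cong refl) (auto simp: projection_def)
  with True assms(1) show ?thesis
    by (simp add: projection_def star_sum sum_product)
qed simp

lemma sum_projection_mult:
  fixes p :: "'i \<Rightarrow> 'a::cstar_algebra"
  assumes "finite I" "i \<in> I"
    and "\<And>i. i \<in> I \<Longrightarrow> projection (p i)"
    and "\<And>i j. i \<in> I \<Longrightarrow> j \<in> I \<Longrightarrow> i \<noteq> j \<Longrightarrow> p i * p j = 0"
  shows "sum p I * p i = p i" "p i * sum p I = p i"
proof -
  have "(\<Sum>j\<in>I. p j * p i) = (\<Sum>j\<in>I. if j = i then p i else 0)"
    "(\<Sum>j\<in>I. p i * p j) = (\<Sum>j\<in>I. if j = i then p i else 0)"
    using assms by (intro sum.cong refl; auto simp: projection_def)+
  with assms(1,2) show "sum p I * p i = p i" "p i * sum p I = p i"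
    by (simp_all add: sum_distrib_left sum_distrib_right)
qed

lemma cstar_le_conjugate:
  assumes "a \<sqsubseteq> b"
  shows "c * a * star c \<sqsubseteq> c * b * star c"
proof -
  obtain z where "b - a = star z * z" using assms unfolding cstar_le_def by blast
  moreover have "c * b * star c - c * a * star c = c * (b - a) * star c"
    by (simp add: left_diff_distrib right_diff_distrib)
  ultimately have "c * b * star c - c * a * star c = star (z * star c) * (z * star c)"
    by (simp add: star_mult star_star mult.assoc)
  then show ?thesis unfolding cstar_le_def by blast
qed

lemma cstar_le_refl: "a \<sqsubseteq> a"
  unfolding cstar_le_def by (intro exI[of _ 0]) simp

text \<open>The difference is the sum of the remaining projections, itself a projection and hence a
  square.\<close>

lemma cstar_le_sum_projections:
  assumes "finite I" "i \<in> I"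
    and "\<And>i. i \<in> I \<Longrightarrow> projection (p i)"
    and "\<And>i j. i \<in> I \<Longrightarrow> j \<in> I \<Longrightarrow> i \<noteq> j \<Longrightarrow> p i * p j = 0"
  shows "p i \<sqsubseteq> sum p I"
proof -
  have "projection (sum p (I - {i}))"
    using assms(3,4) by (intro projection_sum) auto
  moreover have "sum p I - p i = sum p (I - {i})"
    using assms(1,2) by (simp add: sum.remove)
  ultimately show ?thesis
    unfolding cstar_le_def projection_def by metis
qed


section \<open>Order and projections in algebras of operator-valued functions\<close>

text \<open>Evaluated at a vector, the hypothesis makes two squared norms add up to 0, so no
  spectral theory is required.\<close>

lemma bop_sum_squares_eq_0:
  assumes "star u * u + star v * v = (0 :: bop)"
  shows "v = 0"
proof (rule bop_eqI)
  fix x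
  have "cinner (bop_apply u x) (bop_apply u x) + cinner (bop_apply v x) (bop_apply v x)
      = cinner x (bop_apply (star u * u + star v * v) x)"
    by (simp add: cinner_star cinner_add_right)
  then have "complex_of_real ((norm (bop_apply u x))\<^sup>2 + (norm (bop_apply v x))\<^sup>2) = 0"
    by (simp add: cinner_self_norm assms)
  then have "norm (bop_apply v x) = 0"
    by (simp only: of_real_eq_0_iff sum_power2_eq_zero_iff)
  then show "bop_apply v x = bop_apply 0 x" by simp
qed

lemma bcontfun_sum_squares_eq_0:
  fixes u v :: "'i::metric_space \<Rightarrow>\<^sub>C bop"
  assumes "star u * u + star v * v = 0"
  shows "v = 0"
proof (rule bcontfun_eqI)
  fix x
  let ?u = "apply_bcontfun u x" and ?v = "apply_bcontfun v x"
  have "apply_bcontfun (star u * u + star v * v) x = 0" by (simp add: assms)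
  then have "star ?u * ?u + star ?v * ?v = 0"
    by (simp only: plus_bcontfun.rep_eq bcontfun_apply_simps)
  then have "?v = 0" by (rule bop_sum_squares_eq_0)
  then show "apply_bcontfun v x = apply_bcontfun 0 x" by simp
qed

text \<open>Compress \<open>q - s * star s = star z * z\<close> by the complement of
  \<open>q\<close>: the term \<open>q\<close> disappears, and the compressions of
  \<open>star z * z\<close> and \<open>s * star s\<close>, both squares, add up to 0.\<close>

lemma le_projection_absorb:
  fixes s q :: "'i::metric_space \<Rightarrow>\<^sub>C bop"
  assumes le: "s * star s \<sqsubseteq> q" and q: "projection q"
  shows "q * s = s"
proof -
  obtain z where z: "q - s * star s = star z * z"
    using le unfolding cstar_le_def by blast
  \<comment> \<open>These are \<open>z\<close> and \<open>star s\<close> multiplied on the right by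
    1 - q, expanded because the algebra need not be unital.\<close>
  define u v where "u = z - z * q" and "v = star s - star s * q"
  have qq: "star q = q" "q * q = q" "q * (q * y) = q * y" for y
    using q by (simp_all add: projection_def flip: mult.assoc)
  have "star u * u = (star z * z - q * (star z * z)) - (star z * z - q * (star z * z)) * q"
    by (simp add: u_def star_diff star_mult qq left_diff_distrib right_diff_distrib mult.assoc)
  moreover have "star v * v = (s * star s - q * (s * star s)) - (s * star s - q * (s * star s)) * q"
    by (simp add: v_def star_diff star_mult star_star qq left_diff_distrib right_diff_distrib mult.assoc)
  ultimately have "star u * u + star v * v = 0"
    by (simp add: qq left_diff_distrib right_diff_distrib mult.assoc flip: z)
  then have "v = 0" by (rule bcontfun_sum_squares_eq_0)
  then have "star v = 0" by simp
  then show ?thesis by (simp add: v_def star_diff star_mult star_star qq)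
qed

lemma bounded_linear_apply_bcontfun:
  "bounded_linear (\<lambda>f :: 'i::metric_space \<Rightarrow>\<^sub>C 'a::cstar_algebra. apply_bcontfun f x)"
  by (rule bounded_linear_intro[where K = 1]) (auto simp: norm_bounded)


section \<open>Isometries of \<open>\<ell>\<^sup>2(\<nat>)\<close> with orthogonal ranges\<close>

lemma strict_mono_prod_encode: "strict_mono (\<lambda>m. prod_encode (i, m))"
  by (rule strict_monoI_Suc) (simp add: prod_encode_def)

lemma sums_prod_encode_iff:
  fixes f :: "nat \<Rightarrow> 'a::{topological_space,comm_monoid_add}"
  assumes "\<And>n. fst (prod_decode n) \<noteq> i \<Longrightarrow> f n = 0"
  shows "(\<lambda>m. f (prod_encode (i, m))) sums c \<longleftrightarrow> f sums c"
proof (rule sums_mono_reindex[OF strict_mono_prod_encode])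
  fix n assume "n \<notin> range (\<lambda>m. prod_encode (i, m))"
  then have "fst (prod_decode n) \<noteq> i"
    by (metis prod.collapse prod_decode_inverse rangeI)
  then show "f n = 0" by (rule assms)
qed

text \<open>Under the Cantor pairing of indices with pairs, \<open>spread i\<close> copies a
  sequence into row \<open>i\<close>. Different rows give orthogonal ranges.\<close>

lift_definition spread :: "nat \<Rightarrow> ell2 \<Rightarrow> ell2" is
  "\<lambda>i f n. if fst (prod_decode n) = i then f (snd (prod_decode n)) else 0"
  subgoal for i f
    using sums_prod_encode_iff[of i "\<lambda>n. (cmod (if fst (prod_decode n) = i then f (snd (prod_decode n)) else 0))\<^sup>2"]
    by (auto simp: summable_def)
  done

lemma cinner_spread: "cinner (spread i x) (spread j y) = (if i = j then cinner x y else 0)"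
proof (cases "i = j")
  case True
  have "(\<lambda>n. cnj (ell2_coeff (spread i x) n) * ell2_coeff (spread i y) n) sums cinner x y"
    using summable_sums[OF summable_cinner, of x y]
    by (subst sums_prod_encode_iff[of i, symmetric]) (auto simp: spread.rep_eq cinner_def)
  with True show ?thesis by (simp add: cinner_def sums_iff)
next
  case False
  then have "cnj (ell2_coeff (spread i x) n) * ell2_coeff (spread j y) n = 0" for n
    by (auto simp: spread.rep_eq)
  with False show ?thesis by (simp only: cinner_def suminf_zero if_False)
qed

text \<open>The trailing factor \<open>x\<close> expresses V^*V = 1 without a unit constant, and
  makes the identities rewrite rules for right-nested products.\<close>

lemma orthogonal_isometries:
  obtains V :: "nat \<Rightarrow> bop" where "\<And>i x. star (V i) * (V i * x) = x"
    and "\<And>i j x. i \<noteq> j \<Longrightarrow> star (V i) * (V j * x) = 0" and "\<And>i. norm (V i) \<le> 1"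
proof -
  have norm: "norm (spread i x) = norm x" for i x
  proof -
    have "complex_of_real ((norm (spread i x))\<^sup>2) = complex_of_real ((norm x)\<^sup>2)"
      using cinner_spread[of i x i x] by (simp only: cinner_self_norm simp_thms if_True)
    then show ?thesis by (simp only: of_real_eq_iff power2_eq_iff_nonneg norm_ge_zero)
  qed
  have "\<exists>S. bop_apply S = spread i" for i
    by (rule bopI[where K = 1]) (auto intro!: ell2_eqI simp: spread.rep_eq norm)
  then obtain V where V: "\<And>i. bop_apply (V i) = spread i" by metis
  have "bop_apply (star (V i)) (bop_apply (V j) y) = (if i = j then y else 0)" for i j y
    by (rule cinner_eqI) (simp add: V cinner_spread flip: cinner_star)
  then show thesis
    by (intro that[of V] bop_eqI norm_bop_le) (simp_all add: V norm)
qed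


section \<open>Restriction to the representations of a hypergraph\<close>

text \<open>The value 0 off the representations of \<open>H\<close> agrees with that of
  \<open>univ_proj H\<close> and \<open>univ_piso H\<close>, so both algebras live in the same
  product.\<close>

definition restrict_reps ::
  "('v, 'e) hypergraph \<Rightarrow> ('v, 'e) rep_product \<Rightarrow> ('v, 'e) rep_product" where
  "restrict_reps H x = Bcontfun (\<lambda>\<rho>. case of_discrete \<rho> of (p, s) \<Rightarrow>
     if hypergraph_family H p s then apply_bcontfun x \<rho> else 0)"

lemma restrict_reps_apply:
  "apply_bcontfun (restrict_reps H x) (discrete (p, s)) =
     (if hypergraph_family H p s then apply_bcontfun x (discrete (p, s)) else 0)"
  unfolding restrict_reps_def
  by (subst Bcontfun_inverse)
     (auto intro!: discrete_bcontfun[where b = "norm x"] norm_bounded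
       simp: discrete_inverse split: prod.splits)

lemma restrict_reps_simps:
  "restrict_reps H 0 = 0"
  "restrict_reps H (x + y) = restrict_reps H x + restrict_reps H y"
  "restrict_reps H (x * y) = restrict_reps H x * restrict_reps H y"
  "restrict_reps H (star x) = star (restrict_reps H x)"
  "restrict_reps H (c *\<^sub>C x) = c *\<^sub>C restrict_reps H x"
  by (rule discrete_bcontfun_eqI, simp add: restrict_reps_apply bcontfun_apply_simps)+

lemma bounded_linear_restrict_reps: "bounded_linear (restrict_reps H)"
proof (rule bounded_linear_intro[where K = 1])
  fix x
  have "norm (apply_bcontfun (restrict_reps H x) (discrete (p, s))) \<le> norm x" for p s
    by (simp add: restrict_reps_apply norm_bounded)
  then show "norm (restrict_reps H x) \<le> norm x * 1"
    by (auto intro!: norm_bound) (metis of_discrete_inverse surj_pair)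
qed (simp_all add: restrict_reps_simps scaleR_scaleC)

lemma univ_proj_in_hypergraph_cstar: "v \<in> verts H \<Longrightarrow> univ_proj H v \<in> hypergraph_cstar H"
  and univ_piso_in_hypergraph_cstar: "e \<in> edges H \<Longrightarrow> univ_piso H e \<in> hypergraph_cstar H"
  unfolding hypergraph_cstar_def by (simp_all add: subsetD[OF cstar_generated_superset])


section \<open>Removing a source\<close>

text \<open>Together with \<open>source\<close>, \<open>no_sink\<close> excludes an isolated
  \<open>w\<close>. The projection of such a vertex would span a direct summand orthogonal to the
  image, and the image would not be full.\<close>

locale removable_source =
  fixes H :: "('v, 'e) hypergraph" and w :: 'v
  assumes fin: "finite_hypergraph H"
    and w: "w \<in> verts H"
    and source: "is_source H w"
    and no_sink: "\<not> is_sink H w"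
    and ultra: "locally_ultra H w"
begin

abbreviation K :: "('v, 'e) hypergraph" where "K \<equiv> move_S H w"

section \<open>The hypergraphs before and after the move, and their representations\<close>

abbreviation E\<^sub>w :: "'e set" where "E\<^sub>w \<equiv> {e \<in> edges H. w \<in> source_of H e}"

lemma verts_K: "verts K = verts H - {w}"
  and edges_K: "edges K = edges H - E\<^sub>w"
  and range_of_K: "range_of K = range_of H"
  and source_of_K: "source_of K = source_of H"
  by (simp_all add: move_S_def)

lemmas K_simps = verts_K edges_K range_of_K source_of_K

lemma finite_verts: "finite (verts H)" and finite_edges: "finite (edges H)"
  using fin by (auto simp: finite_hypergraph_def)

lemma range_subset: "e \<in> edges H \<Longrightarrow> range_of H e \<subseteq> verts K"
  using fin source by (auto simp: finite_hypergraph_def is_source_def verts_K)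

lemma source_subset: "e \<in> edges K \<Longrightarrow> source_of H e \<subseteq> verts K"
  using fin by (auto simp: finite_hypergraph_def verts_K edges_K)

lemma source_E\<^sub>w: "e \<in> E\<^sub>w \<Longrightarrow> source_of H e = {w}"
  using ultra by (auto simp: locally_ultra_def)

text \<open>By local ultraness a removed edge has \<open>w\<close> as its only source vertex. The
  other vertices keep all their outgoing edges, so (HR2b) at them is unchanged.\<close>

lemma edges_from: "v \<noteq> w \<Longrightarrow> {e \<in> edges K. v \<in> source_of H e} = {e \<in> edges H. v \<in> source_of H e}"
  using source_E\<^sub>w by (auto simp: edges_K)

lemma is_sink_K: "v \<noteq> w \<Longrightarrow> is_sink K v \<longleftrightarrow> is_sink H v"
  using edges_from[of v] by (auto simp: is_sink_def source_of_K)

lemma family_K: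
  assumes "hypergraph_family H p s"
  shows "hypergraph_family K p s"
proof -
  note D = hypergraph_familyD[OF assms]
  show ?thesis
    unfolding hypergraph_family_def
  proof (intro conjI ballI impI)
    fix v assume v: "v \<in> verts K" "\<not> is_sink K v"
    then have "v \<in> verts H" "v \<noteq> w" "\<not> is_sink H v"
      by (auto simp: verts_K is_sink_K)
    then show "p v \<sqsubseteq> (\<Sum>e\<in>{e \<in> edges K. v \<in> source_of K e}. s e * star (s e))"
      using D(6)[of v] by (simp add: source_of_K edges_from)
  qed (simp_all add: D(1-5) K_simps)
qed

text \<open>
  Conjugation by one isometry makes room for the missing partial isometries, which map into the
  ranges of further isometries.
\<close>

lemma family_extension:
  fixes p :: "'v \<Rightarrow> bop" and s :: "'e \<Rightarrow> bop"
  assumes "hypergraph_family K p s"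
  obtains V p' s' where "hypergraph_family H p' s'"
    and "\<And>v. v \<in> verts K \<Longrightarrow> p' v = V * p v * star V"
    and "\<And>e. e \<in> edges K \<Longrightarrow> s' e = V * s e * star V"
    and "\<And>x. star V * (V * x) = x" and "norm V \<le> 1"
proof -
  note D = hypergraph_familyD[OF assms, unfolded range_of_K source_of_K]
  obtain V :: "nat \<Rightarrow> bop" where V: "\<And>i x. star (V i) * (V i * x) = x"
    "\<And>i j x. i \<noteq> j \<Longrightarrow> star (V i) * (V j * x) = 0" "\<And>i. norm (V i) \<le> 1"
    using orthogonal_isometries by blast
  \<comment> \<open>Slot 0 will carry the conjugated family, and slot \<open>Suc (\<iota> e)\<close>
    the range of a removed edge \<open>e\<close>.\<close>
  obtain \<iota> :: "'e \<Rightarrow> nat" where \<iota>: "inj_on \<iota> (edges H)"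
    using finite_imp_inj_to_nat_seg[OF finite_edges] by blast
  \<comment> \<open>(HR1) prescribes \<open>R e\<close> as the initial projection of
    \<open>e\<close>. Its copy \<open>Q e\<close> in the slot of \<open>e\<close> becomes the range
    projection of a removed edge, and \<open>p' w\<close> is the sum of these copies so that (HR2a)
    and (HR2b) hold at \<open>w\<close>.\<close>
  define R where "R e = (\<Sum>v\<in>range_of H e. p v)" for e
  define Q where "Q e = V (Suc (\<iota> e)) * R e * star (V (Suc (\<iota> e)))" for e
  define p' where "p' v = (if v = w then \<Sum>e\<in>E\<^sub>w. Q e else V 0 * p v * star (V 0))" for v
  define s' where "s' e = (if w \<in> source_of H e then V (Suc (\<iota> e)) * R e * star (V 0)
      else V 0 * s e * star (V 0))" for e
  have proj_R: "projection (R e)" if "e \<in> edges H" for e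
    unfolding R_def using range_subset[OF that] by (intro projection_sum D(1,2)) auto
  have R: "star (R e) = R e" "R e * R e = R e" "R e * (R e * x) = R e * x" if "e \<in> edges H" for e x
    using proj_R[OF that] by (simp_all add: projection_def flip: mult.assoc)
  have proj_Q: "projection (Q e)" if "e \<in> edges H" for e
    unfolding projection_def Q_def by (simp add: star_mult star_star mult.assoc V R that)
  have QQ: "Q e * Q f = 0" if "e \<in> edges H" "f \<in> edges H" "e \<noteq> f" for e f
  proof -
    have "\<iota> e \<noteq> \<iota> f" using that inj_onD[OF \<iota>] by blast
    then show ?thesis by (simp add: Q_def mult.assoc V(2))
  qed
  have VQ: "star (V 0) * (Q e * x) = 0" "star (V 0) * Q e = 0" for e x
    by (simp_all add: Q_def mult.assoc V(2))
  have QV: "Q e * (V 0 * x) = 0" for e x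
    by (simp add: Q_def mult.assoc V(2))
  have p_proj: "star (p v) = p v" "p v * p v = p v" "p v * (p v * x) = p v * x" if "v \<in> verts K" for v x
    using D(1)[OF that] by (simp_all add: projection_def flip: mult.assoc)
  have sum_p': "(\<Sum>v\<in>A. p' v) = V 0 * (\<Sum>v\<in>A. p v) * star (V 0)" if "w \<notin> A" for A
  proof -
    have "(\<Sum>v\<in>A. p' v) = (\<Sum>v\<in>A. V 0 * p v * star (V 0))"
      using that by (intro sum.cong) (auto simp: p'_def)
    then show ?thesis by (simp add: sum_distrib_left sum_distrib_right)
  qed
  have s'_E\<^sub>w: "s' e * star (s' e) = Q e" if "e \<in> E\<^sub>w" for e
    using that by (simp add: s'_def Q_def star_mult star_star mult.assoc V R)
  have "hypergraph_family H p' s'"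
    unfolding hypergraph_family_def
  proof (intro conjI ballI impI)
    fix v assume v: "v \<in> verts H"
    show "projection (p' v)"
    proof (cases "v = w")
      case True
      then show ?thesis by (auto simp: p'_def intro!: projection_sum proj_Q QQ)
    next
      case False
      with v show ?thesis
        unfolding projection_def
        by (simp add: p'_def star_mult star_star mult.assoc V p_proj verts_K)
    qed
    fix u assume u: "u \<in> verts H" "v \<noteq> u"
    show "p' v * p' u = 0"
    proof (cases "v = w \<or> u = w")
      case True
      then show ?thesis
        using u(2) by (auto simp: p'_def sum_distrib_left sum_distrib_right mult.assoc VQ QV)
    next
      case False
      then have "p v * (p u * x) = 0" for x
        using D(2)[of v u] u v by (simp add: verts_K flip: mult.assoc)
      with False show ?thesis by (simp add: p'_def mult.assoc V)
    qed
  next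
    fix e assume e: "e \<in> edges H"
    show "partial_isometry (s' e)"
    proof (cases "w \<in> source_of H e")
      case True
      then show ?thesis
        by (simp add: partial_isometry_def s'_def star_mult star_star mult.assoc V R e)
    next
      case False
      then have "s e * star (s e) * s e = s e"
        using D(3)[of e] e by (simp add: edges_K partial_isometry_def)
      then have "s e * (star (s e) * (s e * x)) = s e * x" for x
        by (metis mult.assoc)
      with False show ?thesis
        by (simp add: partial_isometry_def s'_def star_mult star_star mult.assoc V)
    qed
    show "s' e * star (s' e) \<sqsubseteq> (\<Sum>v\<in>source_of H e. p' v)"
    proof (cases "w \<in> source_of H e")
      case True
      with e have "e \<in> E\<^sub>w" by simp
      moreover have "Q e \<sqsubseteq> (\<Sum>e\<in>E\<^sub>w. Q e)"
        using e True finite_edges by (intro cstar_le_sum_projections proj_Q QQ) auto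
      ultimately show ?thesis
        by (simp only: s'_E\<^sub>w source_E\<^sub>w p'_def) simp
    next
      case False
      then have "s e * star (s e) \<sqsubseteq> (\<Sum>v\<in>source_of H e. p v)"
        using D(5)[of e] e by (simp add: edges_K)
      from cstar_le_conjugate[OF this, of "V 0"] False show ?thesis
        by (simp add: sum_p' s'_def star_mult star_star mult.assoc V)
    qed
    fix f assume f: "f \<in> edges H"
    have w_range: "w \<notin> range_of H e" using range_subset[OF e] by (auto simp: verts_K)
    have ss: "star (s e) * (s f * x) = (if e = f then R e * x else 0)"
      if "w \<notin> source_of H e" "w \<notin> source_of H f" for x
      using D(4)[of e f] e f that by (simp add: edges_K R_def flip: mult.assoc)
    have "star (s' e) * s' f = (if e = f then V 0 * R e * star (V 0) else 0)"
    proof (cases "e = f")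
      case True
      then show ?thesis
        using e ss by (cases "w \<in> source_of H e") (simp_all add: s'_def star_mult star_star mult.assoc V R)
    next
      case False
      \<comment> \<open>If \<open>e\<close> or \<open>f\<close> is removed, the two ranges lie in
        different slots; otherwise (HR1) of the given family applies.\<close>
      then have "\<iota> e \<noteq> \<iota> f" using inj_onD[OF \<iota>] e f by blast
      with False ss show ?thesis
        by (cases "w \<in> source_of H e"; cases "w \<in> source_of H f")
           (simp_all add: s'_def star_mult star_star mult.assoc V)
    qed
    then show "star (s' e) * s' f = (if e = f then \<Sum>v\<in>range_of H e. p' v else 0)"
      by (simp only: sum_p'[OF w_range] R_def)
  next
    fix v assume v: "v \<in> verts H" "\<not> is_sink H v"
    show "p' v \<sqsubseteq> (\<Sum>e\<in>{e \<in> edges H. v \<in> source_of H e}. s' e * star (s' e))"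
    proof (cases "v = w")
      case True
      \<comment> \<open>At \<open>w\<close>, (HR2b) holds with equality by the choice of
        \<open>p' w\<close>.\<close>
      have "(\<Sum>e\<in>E\<^sub>w. s' e * star (s' e)) = p' w"
        by (simp only: p'_def if_True refl) (intro sum.cong refl s'_E\<^sub>w)
      with True show ?thesis by (simp add: cstar_le_refl)
    next
      case False
      have *: "p v \<sqsubseteq> (\<Sum>e\<in>{e \<in> edges H. v \<in> source_of H e}. s e * star (s e))"
        using False D(6)[of v] v by (simp add: edges_from[OF False] is_sink_K[OF False] verts_K)
      have "(\<Sum>e\<in>{e \<in> edges H. v \<in> source_of H e}. s' e * star (s' e)) =
          (\<Sum>e\<in>{e \<in> edges H. v \<in> source_of H e}. V 0 * (s e * star (s e)) * star (V 0))"
        using False source_E\<^sub>w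
        by (intro sum.cong) (auto simp: s'_def star_mult star_star mult.assoc V)
      with cstar_le_conjugate[OF *, of "V 0"] False show ?thesis
        by (simp add: p'_def sum_distrib_left sum_distrib_right)
    qed
  qed
  then show thesis
    by (rule that[of p' s' "V 0"]) (auto simp: p'_def s'_def K_simps V)
qed

text \<open>The norm is a supremum over all pairs. At a representation of \<open>K\<close> the value
  of \<open>x\<close> is a compression, by an isometry, of its value at the extended representation
  of \<open>H\<close>; at all other pairs it is 0.\<close>

lemma norm_le_restrict_reps:
  assumes x: "x \<in> hypergraph_cstar K"
  shows "norm x \<le> norm (restrict_reps H x)"
proof (rule norm_bound)
  fix \<rho> :: "(('v \<Rightarrow> bop) \<times> ('e \<Rightarrow> bop)) discrete"
  obtain p s where \<rho>: "\<rho> = discrete (p, s)"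
    by (metis of_discrete_inverse surj_pair)
  note cont = linear_continuous_on[OF bounded_linear_apply_bcontfun]
  show "norm (apply_bcontfun x \<rho>) \<le> norm (restrict_reps H x)"
  proof (cases "hypergraph_family K p s")
    case False
    have "apply_bcontfun x \<rho> = 0"
      using x unfolding hypergraph_cstar_def
    proof (induction rule: cstar_generated_induct)
      case (gen x)
      then show ?case using False by (auto simp: \<rho> univ_proj_apply univ_piso_apply)
    next
      case closed
      show ?case by (intro closed_Collect_eq cont continuous_on_const)
    qed (simp_all add: bcontfun_apply_simps)
    then show ?thesis by simp
  next
    case True
    show ?thesis
    proof (rule family_extension[OF True])
      fix V p' s'
      assume H: "hypergraph_family H p' s'"
        and p': "\<And>v. v \<in> verts K \<Longrightarrow> p' v = V * p v * star V"
        and s': "\<And>e. e \<in> edges K \<Longrightarrow> s' e = V * s e * star V"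
        and V: "\<And>x. star V * (V * x) = x" and norm_V: "norm V \<le> 1"
      let ?ev = "\<lambda>x :: ('v, 'e) rep_product. apply_bcontfun x (discrete (p', s'))"
      \<comment> \<open>Conjugation by \<open>V\<close> is multiplicative since V^*V = 1, so it
        suffices to compare generators. Those of \<open>K\<close> take the values \<open>p'\<close>
        and \<open>s'\<close> here because, by \<open>family_K\<close>, the extension is again a
        representation of \<open>K\<close>.\<close>
      have "?ev x = V * apply_bcontfun x \<rho> * star V"
        using x unfolding hypergraph_cstar_def
      proof (induction rule: cstar_generated_induct)
        case (gen x)
        then show ?case
          using True family_K[OF H] by (auto simp: \<rho> univ_proj_apply univ_piso_apply p' s')
      next
        case closed
        show ?case by (intro closed_Collect_eq cont continuous_intros)
      qed (simp_all add: bcontfun_apply_simps distrib_left distrib_right star_mult star_star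
          mult.assoc V scaleC_mult_left scaleC_mult_right)
      moreover have V': "y * (star V * V) = y" for y
      proof -
        have "star (y * (star V * V)) = star y"
          by (simp add: star_mult star_star mult.assoc V)
        then show ?thesis by (metis star_star)
      qed
      ultimately have "apply_bcontfun x \<rho> = star V * ?ev x * V"
        by (simp add: mult.assoc V V')
      also have "norm \<dots> \<le> norm (star V) * norm (?ev x) * norm V"
        by (intro order_trans[OF norm_mult_ineq] mult_right_mono norm_mult_ineq norm_ge_zero)
      also have "\<dots> \<le> 1 * norm (?ev x) * 1"
        using norm_V by (intro mult_mono) auto
      also have "\<dots> = norm (apply_bcontfun (restrict_reps H x) (discrete (p', s')))"
        by (simp add: restrict_reps_apply H)
      also have "\<dots> \<le> norm (restrict_reps H x)" by (rule norm_bounded)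
      finally show ?thesis .
    qed
  qed
qed

section \<open>The image of the restriction\<close>

abbreviation I :: "('v, 'e) rep_product set" where
  "I \<equiv> restrict_reps H ` hypergraph_cstar K"

text \<open>The restriction is bounded below on a complete subspace, so its image is complete and
  therefore closed. The induction in \<open>compression_in_I\<close> needs this to pass to
  limits.\<close>

lemma cstar_subalgebra_I: "cstar_subalgebra I"
proof -
  have A: "cstar_subalgebra (hypergraph_cstar K)"
    unfolding hypergraph_cstar_def by (rule cstar_subalgebra_generated)
  note A' = cstar_subalgebraD[OF A]
  have "complete I"
  proof (rule complete_isometric_image[where e = 1])
    show "subspace (hypergraph_cstar K)"
      by (rule subspaceI) (simp_all add: A' scaleR_scaleC)
    show "complete (hypergraph_cstar K)"
      using A'(1) by (simp add: complete_eq_closed)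
  qed (simp_all add: bounded_linear_restrict_reps norm_le_restrict_reps)
  then have "closed I" by (rule complete_imp_closed)
  moreover have "0 \<in> I"
    using imageI[OF A'(2), of "restrict_reps H"] by (simp only: restrict_reps_simps)
  moreover have "x + y \<in> I" "x * y \<in> I" if "x \<in> I" "y \<in> I" for x y
    using that by (auto simp flip: restrict_reps_simps(2-) intro!: imageI A'(3-))
  moreover have "star x \<in> I" "c *\<^sub>C x \<in> I" if "x \<in> I" for x c
    using that by (auto simp flip: restrict_reps_simps(2-) intro!: imageI A'(3-))
  ultimately show ?thesis
    unfolding cstar_subalgebra_def by (intro conjI ballI allI)
qed

section \<open>The universal generators relative to \<open>\<p>\<close>\<close>

abbreviation P :: "'v \<Rightarrow> ('v, 'e) rep_product" where "P \<equiv> univ_proj H"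

abbreviation S :: "'e \<Rightarrow> ('v, 'e) rep_product" where "S \<equiv> univ_piso H"

abbreviation A :: "('v, 'e) rep_product set" where "A \<equiv> hypergraph_cstar H"

definition corner_proj :: "('v, 'e) rep_product" (\<open>\<p>\<close>) where
  "\<p> = (\<Sum>v\<in>verts K. P v)"

lemma cstar_subalgebra_A: "cstar_subalgebra A"
  unfolding hypergraph_cstar_def by (rule cstar_subalgebra_generated)

lemmas P_in_A = univ_proj_in_hypergraph_cstar[of _ H]
  and S_in_A = univ_piso_in_hypergraph_cstar[of _ H]

lemma A_induct [consumes 1, case_names P S closed zero add mult star scale]:
  assumes "x \<in> A"
    and "\<And>v. v \<in> verts H \<Longrightarrow> Q (P v)"
    and "\<And>e. e \<in> edges H \<Longrightarrow> Q (S e)"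
    and "closed {x. Q x}"
    and "Q 0"
    and "\<And>x y. Q x \<Longrightarrow> Q y \<Longrightarrow> Q (x + y)"
    and "\<And>x y. Q x \<Longrightarrow> Q y \<Longrightarrow> Q (x * y)"
    and "\<And>x. Q x \<Longrightarrow> Q (star x)"
    and "\<And>c x. Q x \<Longrightarrow> Q (c *\<^sub>C x)"
  shows "Q x"
  using assms(1) unfolding hypergraph_cstar_def
proof (rule cstar_generated_induct)
  fix x assume "x \<in> P ` verts H \<union> S ` edges H"
  then show "Q x" using assms(2,3) by auto
qed (use assms(4-) in simp_all)

lemmas univ = hypergraph_familyD[OF hypergraph_family_univ[OF fin]]

text \<open>At a representation of \<open>H\<close>, which is also one of \<open>K\<close>, both
  sides are \<open>p v\<close>; elsewhere both are 0.\<close>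

lemma restrict_univ_proj: "v \<in> verts K \<Longrightarrow> restrict_reps H (univ_proj K v) = P v"
  by (rule discrete_bcontfun_eqI)
     (auto simp: restrict_reps_apply univ_proj_apply verts_K family_K)

lemma restrict_univ_piso: "e \<in> edges K \<Longrightarrow> restrict_reps H (univ_piso K e) = S e"
  by (rule discrete_bcontfun_eqI)
     (auto simp: restrict_reps_apply univ_piso_apply edges_K family_K)

lemma P_in_I: "v \<in> verts K \<Longrightarrow> P v \<in> I"
proof -
  assume v: "v \<in> verts K"
  from imageI[OF univ_proj_in_hypergraph_cstar[OF this], of "restrict_reps H"] this
  show "P v \<in> I" by (simp only: restrict_univ_proj)
qed

lemma S_in_I: "e \<in> edges K \<Longrightarrow> S e \<in> I"
proof -
  assume e: "e \<in> edges K"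
  from imageI[OF univ_piso_in_hypergraph_cstar[OF this], of "restrict_reps H"] this
  show "S e \<in> I" by (simp only: restrict_univ_piso)
qed

lemma projection_corner_proj: "projection \<p>"
  unfolding corner_proj_def by (intro projection_sum univ) (auto simp: verts_K)

lemma star_corner_proj: "star \<p> = \<p>" and corner_proj_idem: "\<p> * \<p> = \<p>"
  using projection_corner_proj by (simp_all add: projection_def)

lemma corner_proj_P: "v \<in> verts K \<Longrightarrow> \<p> * P v = P v" "v \<in> verts K \<Longrightarrow> P v * \<p> = P v"
  unfolding corner_proj_def using finite_verts univ(1,2)
  by (auto intro!: sum_projection_mult simp: verts_K)

lemma corner_proj_w: "\<p> * P w = 0" "P w * \<p> = 0"
  unfolding corner_proj_def using univ(2) w
  by (auto simp: sum_distrib_left sum_distrib_right verts_K intro!: sum.neutral)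

lemma star_S_S:
  "e \<in> edges H \<Longrightarrow> f \<in> edges H \<Longrightarrow> star (S e) * S f = (if e = f then \<Sum>v\<in>range_of H e. P v else 0)"
  by (rule univ(4))

text \<open>(HR1) leaves either 0 or projections at vertices of a range, none of which is
  \<open>w\<close>. Hence removed edges are covered as well.\<close>

lemma star_S_S_in_I: "e \<in> edges H \<Longrightarrow> f \<in> edges H \<Longrightarrow> star (S e) * S f \<in> I"
  using range_subset
  by (auto simp: star_S_S cstar_subalgebraD(2)[OF cstar_subalgebra_I]
      intro!: cstar_subalgebra_sum[OF cstar_subalgebra_I] P_in_I)

text \<open>The initial projection of \<open>S e\<close> lies under \<open>\<p>\<close> because no
  range contains \<open>w\<close>, and \<open>S e\<close> absorbs its initial projection.\<close>

lemma S_corner_proj: "e \<in> edges H \<Longrightarrow> S e * \<p> = S e"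
proof -
  assume e: "e \<in> edges H"
  have "(\<Sum>v\<in>range_of H e. P v) * \<p> = (\<Sum>v\<in>range_of H e. P v)"
    using range_subset[OF e] by (auto simp: sum_distrib_right corner_proj_P intro!: sum.cong)
  then have "S e * (star (S e) * S e) * \<p> = S e * (star (S e) * S e)"
    by (simp add: star_S_S e mult.assoc)
  moreover have "S e * (star (S e) * S e) = S e"
    using univ(3)[OF e] by (simp add: partial_isometry_def mult.assoc)
  ultimately show ?thesis by (simp only:)
qed

lemma P_w_S: "e \<in> E\<^sub>w \<Longrightarrow> P w * S e = S e"
  using univ(5)[of e] source_E\<^sub>w[of e] univ(1)[OF w] by (intro le_projection_absorb) auto

lemma corner_proj_S_E\<^sub>w: "e \<in> E\<^sub>w \<Longrightarrow> \<p> * S e = 0"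
  by (rule mult_eq_0_if_absorb(1)[OF corner_proj_w(1) P_w_S])

lemma corner_proj_S: "e \<in> edges K \<Longrightarrow> \<p> * S e = S e"
proof -
  assume e: "e \<in> edges K"
  then have e': "e \<in> edges H" by (simp add: edges_K)
  let ?q = "\<Sum>v\<in>source_of H e. P v"
  have "projection ?q"
    using source_subset[OF e] by (intro projection_sum univ) (auto simp: verts_K)
  then have "?q * S e = S e" by (intro le_projection_absorb univ(5) e')
  moreover have "\<p> * ?q = ?q"
    using source_subset[OF e] by (auto simp: sum_distrib_left corner_proj_P intro!: sum.cong)
  ultimately have "\<p> * ?q * S e = S e" "\<p> * (?q * S e) = \<p> * S e" by (simp_all only:)
  then show ?thesis by (simp only: mult.assoc)
qed

lemma P_S_E\<^sub>w: "v \<in> verts K \<Longrightarrow> e \<in> E\<^sub>w \<Longrightarrow> P v * S e = 0"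
  by (rule mult_eq_0_if_absorb(2)[OF corner_proj_P(2) corner_proj_S_E\<^sub>w])

lemma star_S_P: "v \<in> verts K \<Longrightarrow> e \<in> E\<^sub>w \<Longrightarrow> star (S e) * P v = 0"
proof -
  assume v: "v \<in> verts K" and e: "e \<in> E\<^sub>w"
  then have "star (P v) = P v" using univ(1)[of v] by (simp add: projection_def verts_K)
  moreover have "star (P v * S e) = 0" using P_S_E\<^sub>w[OF v e] by simp
  ultimately show ?thesis by (simp add: star_mult)
qed

lemma S_S_E\<^sub>w: "f \<in> edges H \<Longrightarrow> e \<in> E\<^sub>w \<Longrightarrow> S f * S e = 0"
  by (rule mult_eq_0_if_absorb(2)[OF S_corner_proj corner_proj_S_E\<^sub>w])

text \<open>(HR2b) puts \<open>P w\<close> under the sum of range projections, and (HR2a) with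
  source set \<open>{w}\<close> puts each range projection under \<open>P w\<close>. Projections
  that lie under each other are equal.\<close>

lemma P_w_eq: "P w = (\<Sum>e\<in>E\<^sub>w. S e * star (S e))"
proof -
  let ?q = "\<Sum>e\<in>E\<^sub>w. S e * star (S e)"
  have "S e * star (S e) * (S e * star (S e)) = S e * star (S e)" if "e \<in> edges H" for e
    using univ(3)[OF that] by (simp add: partial_isometry_def flip: mult.assoc)
  moreover have "S e * star (S e) * (S f * star (S f)) = 0"
    if "e \<in> edges H" "f \<in> edges H" "e \<noteq> f" for e f
  proof -
    have "S e * star (S e) * (S f * star (S f)) = S e * (star (S e) * S f) * star (S f)"
      by (simp add: mult.assoc)
    also have "\<dots> = 0" using star_S_S[OF that(1,2)] that(3) by simp
    finally show ?thesis .
  qed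
  ultimately have q: "projection ?q"
    by (intro projection_sum) (auto simp: projection_def star_mult star_star)
  have Pw: "star (P w) = P w" "P w * P w = P w"
    using univ(1)[OF w] by (simp_all add: projection_def)
  have "?q * P w = P w"
    using univ(6)[OF w no_sink] q by (intro le_projection_absorb) (simp_all add: Pw)
  moreover have "P w * ?q = ?q"
    by (auto simp: sum_distrib_left P_w_S simp flip: mult.assoc intro!: sum.cong)
  \<comment> \<open>Adjoints turn \<open>P w * ?q = ?q\<close> into \<open>?q * P w = ?q\<close>,
    which is compared with \<open>?q * P w = P w\<close>.\<close>
  then have "star (P w * ?q) = star ?q" by (simp only:)
  ultimately show ?thesis
    using q Pw by (simp add: projection_def star_mult)
qed

section \<open>The unit of \<open>A\<close> and its decomposition\<close>

definition one :: "('v, 'e) rep_product" where "one = (\<Sum>v\<in>verts H. P v)"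

lemma one_eq: "one = \<p> + P w"
  unfolding one_def corner_proj_def using finite_verts w
  by (simp add: verts_K sum.remove add.commute)

lemma one_eq_sum: "one = \<p> * star \<p> + (\<Sum>e\<in>E\<^sub>w. S e * star (S e))"
  by (simp add: one_eq P_w_eq star_corner_proj corner_proj_idem)

text \<open>\<open>one\<close> is a unit for \<open>A\<close> only, since it vanishes at pairs that
  are not representations. Left and right are treated together because the adjoint step exchanges
  them.\<close>

lemma one_mult: "x \<in> A \<Longrightarrow> one * x = x \<and> x * one = x"
proof (induction rule: A_induct)
  case (P v)
  then show ?case
    unfolding one_def using finite_verts univ(1,2) by (auto intro!: sum_projection_mult)
next
  case (S e)
  have "S e * P w = 0"
    by (rule mult_eq_0_if_absorb(2)[OF S_corner_proj[OF S] corner_proj_w(1)])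
  moreover have "P w * S e = 0" if "e \<in> edges K"
    by (rule mult_eq_0_if_absorb(1)[OF corner_proj_w(2) corner_proj_S[OF that]])
  ultimately show ?case
    using S by (cases "w \<in> source_of H e")
      (auto simp: one_eq distrib_left distrib_right S_corner_proj corner_proj_S_E\<^sub>w P_w_S
        corner_proj_S edges_K)
next
  case closed
  show ?case by (intro closed_Collect_conj closed_Collect_eq continuous_intros)
next
  case (star x)
  have "star one = one"
    using univ(1)[OF w] by (simp add: one_eq star_add star_corner_proj projection_def)
  moreover have "star (x * one) = star x" "star (one * x) = star x" using star by simp_all
  ultimately show ?case by (simp add: star_mult)
next
  case (mult x y)
  then have "one * x * y = x * y" "x * (y * one) = x * y" by simp_all
  then show ?case by (simp add: mult.assoc)
qed (simp_all add: distrib_left distrib_right scaleC_mult_left scaleC_mult_right)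

text \<open>This gives one inclusion of the corner identity: \<open>\<p>\<close> fixes the images of
  the generators of \<open>K\<close> from both sides.\<close>

lemma I_subset_corner: "y \<in> I \<Longrightarrow> y \<in> A \<and> \<p> * y = y \<and> y * \<p> = y"
proof (elim imageE)
  fix x assume y: "y = restrict_reps H x" and x: "x \<in> hypergraph_cstar K"
  note A = cstar_subalgebraD[OF cstar_subalgebra_A]
  have "restrict_reps H x \<in> A \<and> \<p> * restrict_reps H x = restrict_reps H x \<and>
      restrict_reps H x * \<p> = restrict_reps H x"
    using x unfolding hypergraph_cstar_def[of K]
  proof (induction rule: cstar_generated_induct)
    case (gen x)
    then show ?case
      by (auto simp: restrict_univ_proj restrict_univ_piso P_in_A S_in_A corner_proj_P corner_proj_S
          S_corner_proj) (auto simp: K_simps P_in_A S_in_A S_corner_proj)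
  next
    case closed
    have "continuous_on UNIV (restrict_reps H)"
      by (rule linear_continuous_on[OF bounded_linear_restrict_reps])
    moreover from A(1) this have "closed (restrict_reps H -` A)"
      by (rule closed_vimage)
    ultimately show ?case
      by (intro closed_Collect_conj closed_Collect_eq continuous_intros) (simp_all add: vimage_def)
  next
    case (star x)
    then have "star (restrict_reps H x * \<p>) = star (restrict_reps H x)"
      "star (\<p> * restrict_reps H x) = star (restrict_reps H x)" by simp_all
    then have "\<p> * star (restrict_reps H x) = star (restrict_reps H x)"
      "star (restrict_reps H x) * \<p> = star (restrict_reps H x)"
      by (simp_all only: star_mult star_corner_proj)
    with star show ?case by (simp add: A(5) restrict_reps_simps)
  next
    case (mult x y)
    then have "\<p> * restrict_reps H x * restrict_reps H y = restrict_reps H x * restrict_reps H y"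
      "restrict_reps H x * (restrict_reps H y * \<p>) = restrict_reps H x * restrict_reps H y"
      by simp_all
    then have "\<p> * (restrict_reps H x * restrict_reps H y) = restrict_reps H x * restrict_reps H y"
      "restrict_reps H x * restrict_reps H y * \<p> = restrict_reps H x * restrict_reps H y"
      by (simp_all only: mult.assoc)
    with mult show ?case by (simp add: A(4) restrict_reps_simps)
  qed (simp_all add: restrict_reps_simps A distrib_left distrib_right scaleC_mult_left scaleC_mult_right)
  with y show ?thesis by simp
qed

text \<open>
  Since \<open>\<p>\<^sup>2 + \<Sum> S\<^sub>e S\<^sub>e\<^sup>*\<close> is the unit, \<open>x \<mapsto> (t\<^sup>* x u)\<^sub>t\<^sub>u\<close> for \<open>t\<close>, \<open>u\<close> among \<open>\<p>\<close> and the \<open>S\<^sub>e\<close> is a matrix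
  representation of \<open>A\<close>, so it suffices to find the entries of the generators.
\<close>

lemma compression_in_I:
  assumes "x \<in> A" "t \<in> insert \<p> (S ` E\<^sub>w)" "u \<in> insert \<p> (S ` E\<^sub>w)"
  shows "star t * x * u \<in> I"
proof -
  note I = cstar_subalgebraD[OF cstar_subalgebra_I]
  let ?T = "insert \<p> (S ` E\<^sub>w)"
  have TA: "t \<in> A" if "t \<in> ?T" for t
    using that by (auto simp: S_in_A corner_proj_def verts_K P_in_A
        intro!: cstar_subalgebra_sum[OF cstar_subalgebra_A])
  \<comment> \<open>All entries are treated at once, because an entry of a product involves a whole
    row and a whole column; \<open>x \<in> A\<close> is carried along so that \<open>one\<close> can
    be inserted.\<close>
  have "(\<forall>t\<in>?T. \<forall>u\<in>?T. star t * x * u \<in> I) \<and> x \<in> A"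
    using assms(1)
  proof (induction rule: A_induct)
    case (P v)
    then show ?case
    proof (cases "v = w")
      case True
      \<comment> \<open>\<open>\<p>\<close> annihilates \<open>P w\<close>. Between removed edges
        \<open>P w\<close> is absorbed, which leaves the products of
        \<open>star_S_S_in_I\<close>.\<close>
      then show ?thesis
        using P by (auto simp: P_in_A star_corner_proj corner_proj_w P_w_S corner_proj_S_E\<^sub>w mult.assoc I(2)
            intro!: star_S_S_in_I)
    next
      case False
      with P have "v \<in> verts K" by (simp add: verts_K)
      then show ?thesis
        using P by (auto simp: P_in_A star_corner_proj corner_proj_P P_S_E\<^sub>w star_S_P mult.assoc I(2)
            P_in_I)
    qed
  next
    case (S e)
    show ?case
    proof (cases "w \<in> source_of H e")
      case True
      \<comment> \<open>Only \<open>u = \<p>\<close> can give a nonzero entry. It is 0 for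
        \<open>t = \<p>\<close>, and a product of the form \<open>star (S f) * S e\<close>
        otherwise.\<close>
      with S show ?thesis
        by (auto simp: S_in_A star_corner_proj S_corner_proj corner_proj_S_E\<^sub>w S_S_E\<^sub>w mult.assoc I(2)
            intro!: star_S_S_in_I)
    next
      case False
      with S have "e \<in> edges K" by (simp add: edges_K)
      \<comment> \<open>Again only \<open>u = \<p>\<close> matters; now \<open>t = \<p>\<close>
        gives \<open>S e\<close> itself.\<close>
      with S False show ?thesis
        by (auto simp: S_in_A star_corner_proj S_corner_proj corner_proj_S S_S_E\<^sub>w mult.assoc I(2)
            intro!: star_S_S_in_I S_in_I)
    qed
  next
    case closed
    have "closed ((\<lambda>x. star t * x * u) -` I)" for t u
      by (intro closed_vimage[OF I(1)] continuous_intros)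
    then show ?case
      using cstar_subalgebraD(1)[OF cstar_subalgebra_A]
      unfolding Ball_def
      by (intro closed_Collect_conj closed_Collect_all closed_Collect_imp open_Collect_const)
         (simp_all add: vimage_def)
  next
    case (mult x y)
    have "star t * (x * y) * u \<in> I" if t: "t \<in> ?T" and u: "u \<in> ?T" for t u
    proof -
      have entry: "(star t * x * v) * (star v * y * u) \<in> I" if "v \<in> ?T" for v
      proof (rule I(4))
        show "star t * x * v \<in> I" "star v * y * u \<in> I" using mult t u that by blast+
      qed
      \<comment> \<open>Matrix multiplication: \<open>one\<close> is inserted between the factors
        and split by \<open>one_eq_sum\<close>.\<close>
      have "star t * (x * y) * u = star t * x * (one * y) * u"
        using mult one_mult by (simp add: mult.assoc)
      also have "\<dots> = (star t * x * \<p>) * (star \<p> * y * u) +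
          (\<Sum>e\<in>E\<^sub>w. (star t * x * S e) * (star (S e) * y * u))"
        by (simp add: one_eq_sum distrib_left distrib_right sum_distrib_left sum_distrib_right mult.assoc)
      also have "\<dots> \<in> I"
        by (intro I(3) cstar_subalgebra_sum[OF cstar_subalgebra_I] entry) simp_all
      finally show ?thesis .
    qed
    with mult show ?case by (simp add: cstar_subalgebraD(4)[OF cstar_subalgebra_A])
  next
    case (star x)
    have "star t * star x * u \<in> I" if "t \<in> ?T" "u \<in> ?T" for t u
    proof -
      have "star (star u * x * t) \<in> I" using star that by (intro I(5)) blast
      then show ?thesis by (simp add: star_mult star_star mult.assoc)
    qed
    with star show ?case by (simp add: cstar_subalgebraD(5)[OF cstar_subalgebra_A])
  qed (simp_all add: I cstar_subalgebraD[OF cstar_subalgebra_A] distrib_left distrib_right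
      scaleC_mult_left scaleC_mult_right)
  with assms(2,3) show ?thesis by blast
qed

section \<open>The image as a full corner\<close>

lemma corner_I: "corner A I"
  unfolding corner_def
proof (intro bexI conjI)
  show "\<p> \<in> A"
    by (auto simp: corner_proj_def verts_K P_in_A intro!: cstar_subalgebra_sum[OF cstar_subalgebra_A])
  show "I = {\<p> * a * \<p> |a. a \<in> A}"
  proof (intro subset_antisym subsetI)
    fix y assume "y \<in> I"
    from I_subset_corner[OF this] show "y \<in> {\<p> * a * \<p> |a. a \<in> A}"
      by (intro CollectI exI[of _ y]) (simp add: mult.assoc)
  next
    fix y assume "y \<in> {\<p> * a * \<p> |a. a \<in> A}"
    then show "y \<in> I"
      using compression_in_I[of _ \<p> \<p>] by (auto simp: star_corner_proj)
  qed
qed (rule projection_corner_proj)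

lemma ideal_eq_A:
  assumes J: "closed_ideal A J" and "I \<subseteq> J"
  shows "J = A"
proof -
  have add: "x + y \<in> J" if "x \<in> J" "y \<in> J" for x y
    using J that by (simp add: closed_ideal_def)
  have mult: "a * x \<in> J" "x * a \<in> J" if "a \<in> A" "x \<in> J" for a x
    using J that by (simp_all add: closed_ideal_def)
  have zero: "0 \<in> J" and sub: "J \<subseteq> A"
    using J by (simp_all add: closed_ideal_def)
  have sum: "sum f X \<in> J" if "\<And>i. i \<in> X \<Longrightarrow> f i \<in> J" for f :: "'e \<Rightarrow> _" and X
    using that by (induction X rule: infinite_finite_induct) (auto simp: zero add)
  have p: "\<p> \<in> J"
    using \<open>I \<subseteq> J\<close> P_in_I cstar_subalgebra_sum[OF cstar_subalgebra_I, of "verts K" P]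
    by (auto simp: corner_proj_def)
  have "S e * star (S e) \<in> J" if "e \<in> E\<^sub>w" for e
  proof -
    from that have e: "e \<in> edges H" by simp
    \<comment> \<open>Multiplying \<open>\<p>\<close> from both sides carries it to the range
      projection of a removed edge, which lies outside the corner.\<close>
    have "S e * \<p> * star (S e) \<in> J"
      using S_in_A[OF e] p by (intro mult cstar_subalgebraD(5)[OF cstar_subalgebra_A])
    then show ?thesis by (simp only: S_corner_proj e)
  qed
  then have "one \<in> J"
    using p by (auto simp: one_eq_sum star_corner_proj corner_proj_idem intro!: add sum)
  have "x \<in> J" if "x \<in> A" for x
    using mult(1)[OF that \<open>one \<in> J\<close>] one_mult[OF that] by simp
  with sub show ?thesis by blast
qed

end

theorem proposition6p7:
  fixes H :: "('v, 'e) hypergraph" and w :: 'v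
  assumes "finite_hypergraph H"
    and "w \<in> verts H"
    and "is_source H w"
    and "\<not> is_sink H w"
    and "locally_ultra H w"
  shows "\<exists>\<pi>. star_hom (hypergraph_cstar (move_S H w)) (hypergraph_cstar H) \<pi> \<and>
             full_corner (hypergraph_cstar H) (\<pi> ` hypergraph_cstar (move_S H w))"
proof -
  interpret removable_source H w by unfold_locales (fact assms)+
  have "star_hom (hypergraph_cstar K) A (restrict_reps H)"
    unfolding star_hom_def using I_subset_corner by (auto simp: restrict_reps_simps)
  moreover have "full_corner A I"
    unfolding full_corner_def using corner_I ideal_eq_A by blast
  ultimately show ?thesis by blast
qed

end
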